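(* For every $\delta>0$ the capacity of the EC-OIC is upper-bounded as $$\mathsf{C}_{\mathrm E}(\mathbf{h},\boldsymbol{\alpha},\sigma)\le\log\left(1+\frac{\mathsf{P}}{\sqrt{2\pi e}\,\sigma}\right)+\sum_{i=0}^{n-1}\lambda_i(1-\mathsf{H}_{[i]})\bar\alpha_i+\sum_{i=0}^{n-1}\frac{\lambda_i\sigma}{\sqrt{2\pi}}\left(1-e^{-\frac{(1+\delta)^2}{2\sigma^2}}\right)$$ for all real numbers $\lambda_0,\dots,\lambda_{n-1}\ge0$, and $$\begin{aligned}\mathsf{C}_{\mathrm E}(\mathbf{h},\boldsymbol{\alpha},\sigma)\le{}&\log\left(1+\frac{\mathsf{P}}{\sqrt{2\pi e}\,\sigma}\right)+\sum_{i=0}^{n-1}\lambda_i(1-\mathsf{H}_{[i]})\bar\alpha_i+\sum_{i=1}^{n-1}\frac{\lambda_i\sigma}{\sqrt{2\pi}}\left(1-e^{-\frac{(1+\delta)^2}{2\sigma^2}}\right)\\&+\lambda_0\sigma\left(\phi\Big(\frac1\sigma\Big)-\phi\Big(\frac\delta\sigma\Big)\right)-\lambda_0\left(\mathcal{Q}\Big(\frac1\sigma\Big)+\mathcal{Q}\Big(\frac\delta\sigma\Big)\right)\end{aligned}$$ for all real numbers $\lambda_0\le0$ and $\lambda_1,\dots,\lambda_{n-1}\ge0$, where $$\mathsf{P}=\int_0^{1+\delta}\exp\left(-\lambda_0y-\sum_{i=1}^{n-1}\lambda_i(y-\mathsf{H}_{[i]})_+\right)dy.$$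
   Context: Let $n\ge 2$ be an integer, $\mathbf{h}=(h_1,\dots,h_n)^{\mathsf T}$ with $h_k>0$ and $\sum_{k=1}^n h_k=1$, and $\boldsymbol{\alpha}=(\alpha_1,\dots,\alpha_n)^{\mathsf T}$ with $1\ge\alpha_1>\alpha_2>\cdots>\alpha_n>0$ and $\alpha_n\le \tfrac12$. Put $\mathsf{H}_{[0]}=0$, $\mathsf{H}_{[k]}=\sum_{i=1}^k h_i$ and $\bar\alpha_k=\frac{\sum_{i=k+1}^n h_i\alpha_i}{1-\mathsf{H}_{[k]}}$ for $0\le k\le n-1$, and $(a)_+=\max\{a,0\}$. $\phi(x)=\frac1{\sqrt{2\pi}}e^{-x^2/2}$ and $\mathcal{Q}(x)=\int_x^\infty\phi(t)\,dt$ (Gaussian Q-function). Channel: $Y=\mathbf{h}^{\mathsf T}\mathbf{X}+Z$ with $Z\sim\mathcal{N}(0,\sigma^2)$, $\sigma>0$, independent of $\mathbf{X}=(X_1,\dots,X_n)^{\mathsf T}$. The EC-OIC capacity is $\mathsf{C}_{\mathrm E}(\mathbf{h},\boldsymbol{\alpha},\sigma)=\sup I(\mathbf{X};Y)$, the supremum being over all laws of $\mathbf{X}$ with $0\le X_k\le1$ (almost surely) and $\mathbb{E}[X_k]=\alpha_k$ for all $k\in\{1,\dots,n\}$. $I$ is mutual information in nats; $\log$ is the natural logarithm. *)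

theory Defs
  imports "HOL-Probability.Probability"
begin

text \<open>
  Vectors indexed by \<open>1, \<dots>, n\<close> are functions on \<^typ>\<open>nat\<close> of which only the values at
  \<open>{1..n}\<close> matter.
\<close>

definition H_sum :: "(nat \<Rightarrow> real) \<Rightarrow> nat \<Rightarrow> real" where
  "H_sum h k = (\<Sum>i = 1..k. h i)"

definition alpha_bar :: "nat \<Rightarrow> (nat \<Rightarrow> real) \<Rightarrow> (nat \<Rightarrow> real) \<Rightarrow> nat \<Rightarrow> real" where
  "alpha_bar n h \<alpha> k = (\<Sum>i = k+1..n. h i * \<alpha> i) / (1 - H_sum h k)"

definition Q_fun :: "real \<Rightarrow> real" where
  "Q_fun x = (LBINT t:{x..}. std_normal_density t)"

abbreviation input_space :: "nat \<Rightarrow> (nat \<Rightarrow> real) measure" where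
  "input_space n \<equiv> (\<Pi>\<^sub>M k\<in>{1..n}. borel)"

definition admissible_laws :: "nat \<Rightarrow> (nat \<Rightarrow> real) \<Rightarrow> (nat \<Rightarrow> real) measure set" where
  "admissible_laws n \<alpha> =
    {\<mu>. prob_space \<mu> \<and> sets \<mu> = sets (input_space n) \<and>
        (\<forall>k\<in>{1..n}. AE x in \<mu>. 0 \<le> x k \<and> x k \<le> 1) \<and>
        (\<forall>k\<in>{1..n}. (LINT x|\<mu>. x k) = \<alpha> k)}"

definition gaussian_noise :: "real \<Rightarrow> real measure" where
  "gaussian_noise \<sigma> = density lborel (\<lambda>z. ennreal (normal_density 0 \<sigma> z))"

text \<open>
  \<open>I(X;Y)\<close> in nats. The underlying probability space is the product of the input law with the
  noise law, so that its two coordinates are \<open>X\<close> and an independent \<open>Z\<close>. The library's mutual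
  information is a real-valued integral; no value is lost, because for \<open>\<sigma> > 0\<close> and a bounded input
  the joint law is absolutely continuous with respect to the product of the marginals, with
  integrable log-density.
\<close>

definition channel_mutual_information ::
  "nat \<Rightarrow> (nat \<Rightarrow> real) \<Rightarrow> real \<Rightarrow> (nat \<Rightarrow> real) measure \<Rightarrow> real" where
  "channel_mutual_information n h \<sigma> \<mu> =
    prob_space.mutual_information (\<mu> \<Otimes>\<^sub>M gaussian_noise \<sigma>) (exp 1) (input_space n) borel
      (\<lambda>(x, z). x) (\<lambda>(x, z). (\<Sum>k = 1..n. h k * x k) + z)"

text \<open>
  The supremum is taken in \<^typ>\<open>ereal\<close>: a supremum in \<^typ>\<open>real\<close> is unspecified for unbounded sets,
  so an upper bound on it would not entail boundedness.
\<close>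

definition EC_OIC_capacity ::
  "nat \<Rightarrow> (nat \<Rightarrow> real) \<Rightarrow> (nat \<Rightarrow> real) \<Rightarrow> real \<Rightarrow> ereal" where
  "EC_OIC_capacity n h \<alpha> \<sigma> =
    (SUP \<mu>\<in>admissible_laws n \<alpha>. ereal (channel_mutual_information n h \<sigma> \<mu>))"

definition P_integral ::
  "nat \<Rightarrow> (nat \<Rightarrow> real) \<Rightarrow> real \<Rightarrow> (nat \<Rightarrow> real) \<Rightarrow> real" where
  "P_integral n h \<delta> lam =
    (LBINT y:{0..1 + \<delta>}.
      exp (- lam 0 * y - (\<Sum>i = 1..n - 1. lam i * max (y - H_sum h i) 0)))"

end

theory Submission
  imports Defs "HOL-Real_Asymp.Real_Asymp"
begin

text \<open>
  For every positive probability density \<open>r\<close> of the output, Gibbs' inequality bounds the mutual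
  information by the mean of \<open>ln (f x y / r y)\<close>, where \<open>f x\<close> is the conditional output density. Take
  \<open>r\<close> proportional to \<open>exp (- \<psi> y)\<close> on \<open>[0, 1 + \<delta>]\<close>, with \<open>\<psi>\<close> the exponent of the integrand of
  \<open>P\<close>, and glue to it the two halves of a Gaussian of variance \<open>\<sigma>\<^sup>2\<close> outside. The total mass is
  \<open>P + sqrt (2 * pi * exp 1) * \<sigma>\<close>, which yields the logarithmic term; the Gaussian tails contribute
  at most \<open>0\<close>. What remains is the mean of \<open>\<psi> Y\<close> on \<open>0 \<le> Y \<le> 1 + \<delta>\<close>, a combination of truncated
  hinge means \<open>(Y - H)\<^sub>+\<close>, which integration by parts evaluates; the mean of the hinge of the noiseless
  output at \<open>H\<^sub>i\<close> is at most the sum of \<open>h\<^sub>k * \<alpha>\<^sub>k\<close> over \<open>k > i\<close>.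
\<close>

subsection \<open>Gibbs' inequality for the channel\<close>

text \<open>From \<open>ln u \<le> u - 1\<close> at \<open>u = r / p\<close>. When \<open>p\<close>
  is the output marginal, the correction \<open>f * r / p - f\<close> has integral 0.\<close>

lemma gibbs_pointwise:
  fixes f p r :: real
  assumes "0 < f" "0 < p" "0 < r"
  shows "f * ln (f / p) \<le> f * ln (f / r) + f * r / p - f"
proof -
  have "ln (f / p) = ln (f / r) + ln (r / p)"
    using assms by (simp add: ln_div)
  also have "\<dots> \<le> ln (f / r) + (r / p - 1)"
    using assms ln_le_minus_one[of "r / p"] by simp
  finally have "f * ln (f / p) \<le> f * (ln (f / r) + (r / p - 1))"
    using assms by (intro mult_left_mono) auto
  then show ?thesis by (simp add: algebra_simps)
qed

text \<open>Exchanging the true output density \<open>p\<close> for another positive density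
  \<open>r\<close> adds the divergence of \<open>p\<close> from \<open>r\<close>, which is
  nonnegative. Integrability is assumed only on the \<open>r\<close> side; the \<open>p\<close> side
  is treated by cases.\<close>

lemma cross_entropy_bound:
  fixes f :: "'a \<Rightarrow> real \<Rightarrow> real" and r p :: "real \<Rightarrow> real"
  assumes "prob_space \<mu>"
    and f_meas: "(\<lambda>(x, y). f x y) \<in> borel_measurable (\<mu> \<Otimes>\<^sub>M lborel)"
    and f_pos: "\<And>x y. 0 < f x y"
    and f_int: "\<And>x. x \<in> space \<mu> \<Longrightarrow> (\<integral>\<^sup>+y. f x y \<partial>lborel) = 1"
    and r: "has_bochner_integral lborel r 1" "\<And>y. 0 < r y"
    and p: "\<And>y. (\<integral>\<^sup>+x. f x y \<partial>\<mu>) = ennreal (p y)" "\<And>y. 0 < p y" "p \<in> borel_measurable borel"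
    and int: "integrable (\<mu> \<Otimes>\<^sub>M lborel) (\<lambda>(x, y). f x y * ln (f x y / r y))"
  shows "(\<integral>(x, y). f x y * ln (f x y / p y) \<partial>(\<mu> \<Otimes>\<^sub>M lborel))
    \<le> (\<integral>(x, y). f x y * ln (f x y / r y) \<partial>(\<mu> \<Otimes>\<^sub>M lborel))"
proof -
  interpret prob_space \<mu> by fact
  interpret pair_sigma_finite \<mu> lborel ..
  note [measurable] = f_meas p(3)
  have [measurable]: "r \<in> borel_measurable borel"
    using borel_measurable_has_bochner_integral[OF r(1)] by simp
  have "(\<integral>\<^sup>+(x, y). ennreal (f x y) \<partial>(\<mu> \<Otimes>\<^sub>M lborel)) = (\<integral>\<^sup>+x. \<integral>\<^sup>+y. f x y \<partial>lborel \<partial>\<mu>)"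
    by (subst lborel.nn_integral_fst[symmetric]) (simp_all add: split_beta')
  also have "\<dots> = 1"
    by (simp add: f_int emeasure_space_1 cong: nn_integral_cong)
  finally have F: "has_bochner_integral (\<mu> \<Otimes>\<^sub>M lborel) (\<lambda>(x, y). f x y) 1"
    using f_pos by (intro has_bochner_integral_nn_integral) (auto simp: less_imp_le split_beta')
  have nnr: "(\<integral>\<^sup>+y. r y \<partial>lborel) = 1"
    using r by (simp add: has_bochner_integral_iff nn_integral_eq_integral less_imp_le)
  \<comment> \<open>Integrating over \<open>x\<close> first turns \<open>f x y\<close> into
    \<open>p y\<close>, which cancels the denominator and leaves the mass of
    \<open>r\<close>.\<close>
  have "(\<integral>\<^sup>+(x, y). ennreal (f x y * r y / p y) \<partial>(\<mu> \<Otimes>\<^sub>M lborel))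
      = (\<integral>\<^sup>+y. \<integral>\<^sup>+x. ennreal (f x y * r y / p y) \<partial>\<mu> \<partial>lborel)"
    by (subst nn_integral_snd[symmetric]) (simp_all add: split_beta')
  also have "\<dots> = (\<integral>\<^sup>+y. (\<integral>\<^sup>+x. ennreal (f x y) \<partial>\<mu>) * ennreal (r y / p y) \<partial>lborel)"
  proof (rule nn_integral_cong)
    fix y :: real
    have [measurable]: "(\<lambda>x. f x y) \<in> borel_measurable \<mu>"
      using measurable_compose[OF measurable_Pair2' f_meas, of y] by simp
    have "(\<integral>\<^sup>+x. ennreal (f x y * r y / p y) \<partial>\<mu>) = (\<integral>\<^sup>+x. ennreal (f x y) * ennreal (r y / p y) \<partial>\<mu>)"
      using f_pos p(2) r(2) by (intro nn_integral_cong) (simp add: ennreal_mult[symmetric] less_imp_le)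
    also have "\<dots> = (\<integral>\<^sup>+x. ennreal (f x y) \<partial>\<mu>) * ennreal (r y / p y)"
      by (rule nn_integral_multc) simp
    finally show "(\<integral>\<^sup>+x. ennreal (f x y * r y / p y) \<partial>\<mu>) = \<dots>" .
  qed
  also have "\<dots> = (\<integral>\<^sup>+y. r y \<partial>lborel)"
    using p r(2)
    by (intro nn_integral_cong) (simp add: p(1) ennreal_mult[symmetric] less_imp_le less_imp_neq[symmetric])
  finally have FR: "has_bochner_integral (\<mu> \<Otimes>\<^sub>M lborel) (\<lambda>(x, y). f x y * r y / p y) 1"
    using f_pos p(2) r(2)
    by (intro has_bochner_integral_nn_integral) (auto simp: less_imp_le split_beta' nnr)
  have "(\<integral>\<^sup>+(x, y). ennreal (r y) \<partial>(\<mu> \<Otimes>\<^sub>M lborel)) = (\<integral>\<^sup>+x. \<integral>\<^sup>+y. r y \<partial>lborel \<partial>\<mu>)"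
    by (subst lborel.nn_integral_fst[symmetric]) (simp_all add: split_beta')
  also have "\<dots> = 1"
    by (simp add: nnr emeasure_space_1)
  finally have R: "has_bochner_integral (\<mu> \<Otimes>\<^sub>M lborel) (\<lambda>(x, y). r y) 1"
    using r(2) by (intro has_bochner_integral_nn_integral) (auto simp: less_imp_le split_beta')
  define U where "U = (\<lambda>(x, y). f x y * ln (f x y / r y) + f x y * r y / p y - f x y)"
  have U: "integrable (\<mu> \<Otimes>\<^sub>M lborel) U"
    "integral\<^sup>L (\<mu> \<Otimes>\<^sub>M lborel) U = (\<integral>(x, y). f x y * ln (f x y / r y) \<partial>(\<mu> \<Otimes>\<^sub>M lborel))"
    using int F FR unfolding U_def by (simp_all add: split_beta' has_bochner_integral_iff)
  show ?thesis
  proof (cases "integrable (\<mu> \<Otimes>\<^sub>M lborel) (\<lambda>(x, y). f x y * ln (f x y / p y))")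
    case True
    have "(\<integral>(x, y). f x y * ln (f x y / p y) \<partial>(\<mu> \<Otimes>\<^sub>M lborel)) \<le> integral\<^sup>L (\<mu> \<Otimes>\<^sub>M lborel) U"
      using True U(1)
      by (rule integral_mono) (use gibbs_pointwise[OF f_pos p(2) r(2)] in \<open>auto simp: U_def\<close>)
    then show ?thesis by (simp add: U)
  next
    case False
    \<comment> \<open>A non-integrable left side is 0 by convention, so only nonnegativity of the
      right side is at stake. It follows because \<open>f\<close> and \<open>r\<close> both have
      mass 1.\<close>
    have "0 = (\<integral>(x, y). f x y - r y \<partial>(\<mu> \<Otimes>\<^sub>M lborel))"
      using F R by (simp add: split_beta' has_bochner_integral_iff)
    also have "\<dots> \<le> (\<integral>(x, y). f x y * ln (f x y / r y) \<partial>(\<mu> \<Otimes>\<^sub>M lborel))"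
    proof (rule integral_mono)
      show "integrable (\<mu> \<Otimes>\<^sub>M lborel) (\<lambda>(x, y). f x y - r y)"
        using F R by (simp add: split_beta' has_bochner_integral_iff)
      fix z :: "'a \<times> real"
      show "(case z of (x, y) \<Rightarrow> f x y - r y) \<le> (case z of (x, y) \<Rightarrow> f x y * ln (f x y / r y))"
        \<comment> \<open>Taking \<open>p = f\<close> makes the left side of the pointwise
          inequality 0.\<close>
        using gibbs_pointwise[OF f_pos f_pos r(2), of "fst z" "snd z" "fst z" "snd z" "snd z"]
          f_pos[of "fst z" "snd z"]
        by (simp add: split_beta)
    qed (rule int)
    finally show ?thesis
      using False by (simp add: not_integrable_integral_eq)
  qed
qed

section \<open>Channel densities and mutual information\<close>

lemma nn_integral_normal_density [simp]:
  "0 < \<sigma> \<Longrightarrow> (\<integral>\<^sup>+y. ennreal (normal_density m \<sigma> y) \<partial>lborel) = 1"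
  by (simp add: nn_integral_eq_integral)

lemma measurable_input_sum [measurable]:
  "(\<lambda>x. \<Sum>k = 1..n. h k * x k) \<in> borel_measurable (input_space n)"
  by (intro borel_measurable_sum borel_measurable_times measurable_component_singleton) auto

lemma measurable_normal_density_mean [measurable (raw)]:
  assumes [measurable]: "a \<in> borel_measurable M" "b \<in> borel_measurable M"
  shows "(\<lambda>x. normal_density (a x) \<sigma> (b x)) \<in> borel_measurable M"
  unfolding normal_density_def by measurable

lemma normal_density_shift: "normal_density m \<sigma> (m + z) = normal_density 0 \<sigma> z"
  by (simp add: normal_density_def)

text \<open>Relative to \<open>\<mu> \<Otimes>\<^sub>M lborel\<close> the pair \<open>(X, Y)\<close>
  has the Gaussian density \<open>f x y\<close>, while \<open>X\<close> has density 1 and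
  \<open>Y\<close> the mixture \<open>p\<close>; so the mutual information is the mean of
  \<open>ln (f / p)\<close>. Taking \<open>\<mu>\<close> itself as reference admits inputs without a
  Lebesgue density.\<close>

lemma channel_mutual_information_le:
  fixes n :: nat and h :: "nat \<Rightarrow> real" and r :: "real \<Rightarrow> real"
  defines "s \<equiv> \<lambda>x. \<Sum>k = 1..n. h k * x k"
  assumes "prob_space \<mu>" and sets_mu: "sets \<mu> = sets (input_space n)" and \<sigma>: "0 < \<sigma>"
    and r: "has_bochner_integral lborel r 1" "\<And>y. 0 < r y"
    and int: "integrable (\<mu> \<Otimes>\<^sub>M lborel)
      (\<lambda>(x, y). normal_density (s x) \<sigma> y * ln (normal_density (s x) \<sigma> y / r y))"
  shows "channel_mutual_information n h \<sigma> \<mu> \<le>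
    (\<integral>(x, y). normal_density (s x) \<sigma> y * ln (normal_density (s x) \<sigma> y / r y) \<partial>(\<mu> \<Otimes>\<^sub>M lborel))"
proof -
  interpret mu: prob_space \<mu> by fact
  interpret noise: prob_space "gaussian_noise \<sigma>"
    unfolding gaussian_noise_def using \<sigma> by (rule prob_space_normal_density)
  interpret pair_prob_space \<mu> "gaussian_noise \<sigma>" ..
  let ?M = "\<mu> \<Otimes>\<^sub>M gaussian_noise \<sigma>"
  interpret information_space ?M "exp 1"
    by unfold_locales simp
  interpret ml: pair_sigma_finite \<mu> lborel ..
  note [measurable_cong] = sets_mu
  have [measurable_cong]: "sets (gaussian_noise \<sigma>) = sets borel"
    by (simp add: gaussian_noise_def)
  have s[measurable]: "s \<in> borel_measurable \<mu>"
    unfolding s_def by measurable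
  define X where "X = (\<lambda>(x :: nat \<Rightarrow> real, z :: real). x)"
  define Y where "Y = (\<lambda>(x, z :: real). s x + z)"
  have [measurable]: "X \<in> ?M \<rightarrow>\<^sub>M \<mu>" "Y \<in> borel_measurable ?M"
    unfolding X_def Y_def by (simp_all add: split_beta')
  define f where "f = (\<lambda>x. normal_density (s x) \<sigma>)"
  have f_pos: "0 < f x y" for x y
    using \<sigma> by (simp add: f_def normal_density_pos)
  have f_meas[measurable]: "(\<lambda>(x, y). f x y) \<in> borel_measurable (\<mu> \<Otimes>\<^sub>M lborel)"
    unfolding f_def split_beta' by measurable
  define p where "p y = (\<integral>x. f x y \<partial>\<mu>)" for y
  \<comment> \<open>The peak value bounds \<open>f\<close> uniformly, which makes the mixture
    \<open>p\<close> finite everywhere.\<close>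
  have f_le: "f x y \<le> 1 / sqrt (2 * pi * \<sigma>\<^sup>2)" for x y
    unfolding f_def normal_density_def using \<sigma> by (intro mult_right_le_one_le) auto
  have fy_meas: "(\<lambda>x. f x y) \<in> borel_measurable \<mu>" for y
    unfolding f_def by measurable
  have f_int: "integrable \<mu> (\<lambda>x. f x y)" for y
    using fy_meas f_le f_pos
    by (intro mu.integrable_const_bound[where B = "1 / sqrt (2 * pi * \<sigma>\<^sup>2)"]) (auto simp: less_imp_le)
  have p_eq: "(\<integral>\<^sup>+x. f x y \<partial>\<mu>) = ennreal (p y)" for y
    unfolding p_def using f_pos f_int by (intro nn_integral_eq_integral) (auto simp: less_imp_le)
  have p_pos: "0 < p y" for y
  proof -
    have "p y \<noteq> 0"
      unfolding p_def using f_pos f_int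
      by (subst integral_nonneg_eq_0_iff_AE)
         (auto simp: less_imp_le less_imp_neq[symmetric])
    moreover have "0 \<le> p y"
      unfolding p_def using f_pos by (intro integral_nonneg_AE) (auto simp: less_imp_le)
    ultimately show ?thesis by simp
  qed
  have p_meas[measurable]: "p \<in> borel_measurable borel"
  proof -
    have "(\<lambda>(y, x). f x y) \<in> borel_measurable (borel \<Otimes>\<^sub>M \<mu>)"
      unfolding f_def split_beta' by measurable
    then show ?thesis
      unfolding p_def[abs_def] by (intro mu.borel_measurable_lebesgue_integral) auto
  qed
  have XY: "distributed ?M (\<mu> \<Otimes>\<^sub>M lborel) (\<lambda>w. (X w, Y w)) (\<lambda>w. ennreal (case w of (x, y) \<Rightarrow> f x y))"
    unfolding distributed_def
  proof (intro conjI measure_eqI)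
    fix A assume A: "A \<in> sets (distr ?M (\<mu> \<Otimes>\<^sub>M lborel) (\<lambda>w. (X w, Y w)))"
    then have [measurable]: "A \<in> sets (\<mu> \<Otimes>\<^sub>M borel)"
      by (simp cong: sets_pair_measure_cong)
    have "emeasure (distr ?M (\<mu> \<Otimes>\<^sub>M lborel) (\<lambda>w. (X w, Y w))) A
        = (\<integral>\<^sup>+w. indicator A w \<partial>(distr ?M (\<mu> \<Otimes>\<^sub>M lborel) (\<lambda>w. (X w, Y w))))"
      using A by simp
    also have "\<dots> = (\<integral>\<^sup>+w. indicator A (X w, Y w) \<partial>?M)"
      by (rule nn_integral_distr) measurable
    also have "\<dots> = (\<integral>\<^sup>+x. \<integral>\<^sup>+z. indicator A (x, s x + z) \<partial>gaussian_noise \<sigma> \<partial>\<mu>)"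
      by (subst noise.nn_integral_fst[symmetric]) (simp_all add: X_def Y_def)
    also have "\<dots> = (\<integral>\<^sup>+x. \<integral>\<^sup>+y. ennreal (f x y) * indicator A (x, y) \<partial>lborel \<partial>\<mu>)"
    proof (rule nn_integral_cong)
      fix x assume [measurable]: "x \<in> space \<mu>"
      have "(\<integral>\<^sup>+z. indicator A (x, s x + z) \<partial>gaussian_noise \<sigma>)
          = (\<integral>\<^sup>+z. ennreal (normal_density 0 \<sigma> z) * indicator A (x, s x + z) \<partial>lborel)"
        unfolding gaussian_noise_def by (rule nn_integral_density) measurable
      \<comment> \<open>Substituting \<open>y = s x + z\<close> at fixed \<open>x\<close> moves the
        mean of the Gaussian from 0 to \<open>s x\<close>.\<close>
      also have "\<dots> = (\<integral>\<^sup>+y. ennreal (f x y) * indicator A (x, y) \<partial>lborel)"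
        by (subst nn_integral_real_affine[where c = 1 and t = "s x"])
           (simp_all add: f_def normal_density_shift)
      finally show "(\<integral>\<^sup>+z. indicator A (x, s x + z) \<partial>gaussian_noise \<sigma>) = \<dots>" .
    qed
    also have "\<dots> = (\<integral>\<^sup>+w. ennreal (case w of (x, y) \<Rightarrow> f x y) * indicator A w \<partial>(\<mu> \<Otimes>\<^sub>M lborel))"
      by (subst lborel.nn_integral_fst[symmetric]) simp_all
    also have "\<dots> = emeasure (density (\<mu> \<Otimes>\<^sub>M lborel) (\<lambda>w. ennreal (case w of (x, y) \<Rightarrow> f x y))) A"
      using A by (intro emeasure_density[symmetric]) auto
    finally show "emeasure (distr ?M (\<mu> \<Otimes>\<^sub>M lborel) (\<lambda>w. (X w, Y w))) A = \<dots>" .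
  qed (simp_all, measurable)
  have dY: "distributed ?M lborel Y (\<lambda>y. ennreal (p y))"
    using distr_marginal2[OF mu.sigma_finite_measure_axioms lborel.sigma_finite_measure_axioms XY]
    by (simp add: p_eq)
  have "distr ?M \<mu> X = density \<mu> (\<lambda>x. ennreal 1)"
    using noise.distr_pair_fst[of \<mu>]
    by (simp add: X_def density_1 fst_def[abs_def])
  then have dX: "distributed ?M \<mu> X (\<lambda>x. ennreal 1)"
    by (simp add: distributed_def)
  have "channel_mutual_information n h \<sigma> \<mu> = mutual_information (exp 1) (input_space n) borel X Y"
    by (simp add: channel_mutual_information_def X_def Y_def s_def)
  \<comment> \<open>A push-forward depends on its target only through the sigma-algebra, so the
    reference spaces may be replaced by \<open>\<mu>\<close> and \<open>lborel\<close>.\<close>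
  also have "\<dots> = mutual_information (exp 1) \<mu> lborel X Y"
  proof -
    have "distr ?M (input_space n) X = distr ?M \<mu> X"
      "distr ?M borel Y = distr ?M lborel Y"
      by (rule distr_cong; simp add: sets_mu)+
    moreover have "distr ?M (input_space n \<Otimes>\<^sub>M borel) (\<lambda>w. (X w, Y w)) =
        distr ?M (\<mu> \<Otimes>\<^sub>M lborel) (\<lambda>w. (X w, Y w))"
      by (rule distr_cong) (simp_all add: sets_mu cong: sets_pair_measure_cong)
    ultimately show ?thesis
      by (simp add: mutual_information_def)
  qed
  also have "\<dots> = (\<integral>(x, y). f x y * ln (f x y / p y) \<partial>(\<mu> \<Otimes>\<^sub>M lborel))"
    using f_pos p_pos
    by (subst mutual_information_distr[OF mu.sigma_finite_measure_axioms
          lborel.sigma_finite_measure_axioms dX _ dY _ XY])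
       (auto simp: less_imp_le split_beta' log_def)
  also have "\<dots> \<le> (\<integral>(x, y). f x y * ln (f x y / r y) \<partial>(\<mu> \<Otimes>\<^sub>M lborel))"
  proof (rule cross_entropy_bound[OF mu.prob_space_axioms f_meas f_pos _ r p_eq p_pos p_meas])
    show "(\<integral>\<^sup>+y. f x y \<partial>lborel) = 1" for x
      using \<sigma> by (simp add: f_def)
    show "integrable (\<mu> \<Otimes>\<^sub>M lborel) (\<lambda>(x, y). f x y * ln (f x y / r y))"
      using int by (simp add: f_def)
  qed
  finally show ?thesis unfolding f_def .
qed

subsection \<open>Truncated Gaussian moments\<close>

lemma normal_density_has_derivative:
  assumes "0 < \<sigma>"
  shows "(normal_density m \<sigma> has_real_derivative (- (y - m) / \<sigma>\<^sup>2 * normal_density m \<sigma> y)) (at y)"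
proof -
  have "((\<lambda>x. exp (- (x - m)\<^sup>2 / (2 * \<sigma>\<^sup>2))) has_real_derivative
      (- (y - m) / \<sigma>\<^sup>2 * exp (- (y - m)\<^sup>2 / (2 * \<sigma>\<^sup>2)))) (at y)"
    using assms by (auto intro!: derivative_eq_intros simp: field_simps power2_eq_square)
  from DERIV_cmult[OF this, of "1 / sqrt (2 * pi * \<sigma>\<^sup>2)"] show ?thesis
    unfolding normal_density_def[abs_def] by (simp add: mult_ac)
qed

lemma normal_density_continuous [continuous_intros]:
  "0 < \<sigma> \<Longrightarrow> continuous_on A (normal_density m \<sigma>)"
  using normal_density_has_derivative
  by (intro continuous_at_imp_continuous_on ballI DERIV_isCont) blast

text \<open>Stein's identity in the form of a primitive. The affine factor will be the constant 1
  for truncated means, and a factor vanishing at the cut point for the tails.\<close>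

lemma stein_has_derivative:
  assumes "0 < \<sigma>"
  shows "((\<lambda>y. - (\<sigma>\<^sup>2 * ((p + q * y) * normal_density m \<sigma> y))) has_real_derivative
      normal_density m \<sigma> y * ((y - m) * (p + q * y) - \<sigma>\<^sup>2 * q)) (at y)"
  using assms
  by (auto intro!: derivative_eq_intros normal_density_has_derivative simp: field_simps)

lemma stein_integrable:
  assumes "0 < \<sigma>"
  shows "integrable lborel (\<lambda>y. normal_density m \<sigma> y * ((y - m) * (p + q * y) - \<sigma>\<^sup>2 * q))"
proof -
  \<comment> \<open>Expanding \<open>p + q * y\<close> about \<open>m\<close> leaves only central
    moments of order at most 2.\<close>
  have "integrable lborel (\<lambda>y. q * (normal_density m \<sigma> y * (y - m) ^ 2)
      + (p + q * m) * (normal_density m \<sigma> y * (y - m) ^ 1) - \<sigma>\<^sup>2 * q * normal_density m \<sigma> y)"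
    using assms by (intro Bochner_Integration.integrable_add Bochner_Integration.integrable_diff
        integrable_mult_right integrable_normal_moment integrable_normal_density) auto
  then show ?thesis
    by (rule back_subst[where P = "integrable lborel"])
       (auto simp: algebra_simps power2_eq_square)
qed

lemma integrable_mult_indicator_right:
  fixes f :: "real \<Rightarrow> real"
  assumes "integrable lborel f" "A \<in> sets borel"
  shows "integrable lborel (\<lambda>y. f y * indicator A y)"
  using integrable_real_mult_indicator[of A lborel f] assms by simp

lemma stein_Icc:
  assumes "0 < \<sigma>" "a \<le> b"
  shows "(\<integral>y. normal_density m \<sigma> y * ((y - m) * (p + q * y) - \<sigma>\<^sup>2 * q) * indicator {a..b} y \<partial>lborel)
    = \<sigma>\<^sup>2 * ((p + q * a) * normal_density m \<sigma> a - (p + q * b) * normal_density m \<sigma> b)"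
  using assms
  by (subst integral_FTC_Icc_real[OF _ stein_has_derivative])
     (auto intro!: continuous_intros continuous_on_interior[of UNIV] simp: algebra_simps)

lemma stein_greaterThan:
  assumes "0 < \<sigma>"
  shows "(\<integral>y. normal_density m \<sigma> y * ((y - m) * (p + q * y) - \<sigma>\<^sup>2 * q) * indicator {a<..} y \<partial>lborel)
    = \<sigma>\<^sup>2 * ((p + q * a) * normal_density m \<sigma> a)"
proof -
  let ?g = "\<lambda>y. normal_density m \<sigma> y * ((y - m) * (p + q * y) - \<sigma>\<^sup>2 * q)"
  let ?F = "\<lambda>y. - (\<sigma>\<^sup>2 * ((p + q * y) * normal_density m \<sigma> y))"
  have "(LBINT y=ereal a..\<infinity>. ?g y) = 0 - ?F a"
  proof (rule interval_integral_FTC_integrable)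
    show "set_integrable lborel (einterval (ereal a) \<infinity>) ?g"
      unfolding set_integrable_def
      by (intro integrable_mult_indicator stein_integrable assms) auto
    show "isCont ?g y" for y
      using assms by (auto intro!: continuous_intros continuous_on_interior[of UNIV])
    have "(?F \<longlongrightarrow> ?F a) (at_right a)"
      using DERIV_isCont[OF stein_has_derivative[OF assms]]
      unfolding isCont_def by (rule tendsto_within_subset) auto
    then show "((?F \<circ> real_of_ereal) \<longlongrightarrow> ?F a) (at_right (ereal a))"
      by (simp add: ereal_tendsto_simps1)
    \<comment> \<open>Gaussian decay beats the affine factor, so infinity contributes no boundary
      term. The limit is written in the shape of \<open>?F\<close> so that the limit rules can
      decompose it.\<close>
    have "(?F \<longlongrightarrow> - (\<sigma>\<^sup>2 * 0)) at_top"
      by (intro tendsto_intros) (use assms in \<open>unfold normal_density_def, real_asymp\<close>)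
    then show "((?F \<circ> real_of_ereal) \<longlongrightarrow> 0) (at_left \<infinity>)"
      by (simp add: ereal_tendsto_simps1)
  qed (use stein_has_derivative[OF assms] in \<open>auto simp: has_real_derivative_iff_has_vector_derivative\<close>)
  then show ?thesis
    by (simp add: interval_lebesgue_integral_def set_lebesgue_integral_def einterval_eq mult.commute)
qed

lemma stein_lessThan:
  assumes "0 < \<sigma>"
  shows "(\<integral>y. normal_density m \<sigma> y * ((y - m) * (p + q * y) - \<sigma>\<^sup>2 * q) * indicator {..<a} y \<partial>lborel)
    = - (\<sigma>\<^sup>2 * ((p + q * a) * normal_density m \<sigma> a))"
proof -
  let ?g = "\<lambda>y. normal_density m \<sigma> y * ((y - m) * (p + q * y) - \<sigma>\<^sup>2 * q)"
  let ?F = "\<lambda>y. - (\<sigma>\<^sup>2 * ((p + q * y) * normal_density m \<sigma> y))"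
  have "(LBINT y=-\<infinity>..ereal a. ?g y) = ?F a - 0"
  proof (rule interval_integral_FTC_integrable)
    show "set_integrable lborel (einterval (-\<infinity>) (ereal a)) ?g"
      unfolding set_integrable_def
      by (intro integrable_mult_indicator stein_integrable assms) auto
    show "isCont ?g y" for y
      using assms by (auto intro!: continuous_intros continuous_on_interior[of UNIV])
    have "(?F \<longlongrightarrow> ?F a) (at_left a)"
      using DERIV_isCont[OF stein_has_derivative[OF assms]]
      unfolding isCont_def by (rule tendsto_within_subset) auto
    then show "((?F \<circ> real_of_ereal) \<longlongrightarrow> ?F a) (at_left (ereal a))"
      by (simp add: ereal_tendsto_simps1)
    have "(?F \<longlongrightarrow> - (\<sigma>\<^sup>2 * 0)) at_bot"
      by (intro tendsto_intros) (use assms in \<open>unfold normal_density_def, real_asymp\<close>)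
    then show "((?F \<circ> real_of_ereal) \<longlongrightarrow> 0) (at_right (-\<infinity>))"
      by (simp add: ereal_tendsto_simps1)
  qed (use stein_has_derivative[OF assms] in \<open>auto simp: has_real_derivative_iff_has_vector_derivative\<close>)
  then show ?thesis
    by (simp add: interval_lebesgue_integral_def set_lebesgue_integral_def einterval_eq mult.commute)
qed

section \<open>Gaussian tail and interval masses\<close>

lemma normal_density_affine_std:
  "0 < \<sigma> \<Longrightarrow> normal_density m \<sigma> (m + \<sigma> * x) * \<sigma> = std_normal_density x"
  "0 < \<sigma> \<Longrightarrow> normal_density m \<sigma> (m - \<sigma> * x) * \<sigma> = std_normal_density x"
  by (simp_all add: normal_density_def power_mult_distrib real_sqrt_mult)

text \<open>The end point is a null set. The open form fits the partition of the line into
  \<open>{..<a}\<close>, \<open>{a..b}\<close> and \<open>{b<..}\<close>.\<close>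

lemma Q_fun_greaterThan: "(\<integral>x. std_normal_density x * indicator {a<..} x \<partial>lborel) = Q_fun a"
  unfolding Q_fun_def set_lebesgue_integral_def
proof (rule integral_cong_AE)
  show "AE x in lborel. std_normal_density x * indicator {a<..} x = indicator {a..} x *\<^sub>R std_normal_density x"
    using AE_lborel_singleton[of a] by eventually_elim (auto simp: indicator_def)
qed auto

lemma normal_upper_tail:
  assumes "0 < \<sigma>"
  shows "(\<integral>y. normal_density m \<sigma> y * indicator {a<..} y \<partial>lborel) = Q_fun ((a - m) / \<sigma>)"
proof -
  have "(\<integral>y. normal_density m \<sigma> y * indicator {a<..} y \<partial>lborel)
      = \<sigma> * (\<integral>x. normal_density m \<sigma> (m + \<sigma> * x) * indicator {a<..} (m + \<sigma> * x) \<partial>lborel)"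
    using assms by (subst lborel_integral_real_affine[where c = \<sigma> and t = m]) auto
  also have "\<dots> = (\<integral>x. (normal_density m \<sigma> (m + \<sigma> * x) * \<sigma>) * indicator {a<..} (m + \<sigma> * x) \<partial>lborel)"
    by (subst integral_mult_right_zero[symmetric]) (simp add: mult_ac)
  also have "\<dots> = (\<integral>x. std_normal_density x * indicator {(a - m) / \<sigma><..} x \<partial>lborel)"
    using assms normal_density_affine_std(1)[OF assms]
    by (intro Bochner_Integration.integral_cong) (auto simp: indicator_def field_simps)
  finally show ?thesis by (simp add: Q_fun_greaterThan)
qed

lemma normal_lower_tail:
  assumes "0 < \<sigma>"
  shows "(\<integral>y. normal_density m \<sigma> y * indicator {..<a} y \<partial>lborel) = Q_fun ((m - a) / \<sigma>)"
proof -
  have "(\<integral>y. normal_density m \<sigma> y * indicator {..<a} y \<partial>lborel)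
      = \<sigma> * (\<integral>x. normal_density m \<sigma> (m - \<sigma> * x) * indicator {..<a} (m - \<sigma> * x) \<partial>lborel)"
    \<comment> \<open>The negative scale reflects the lower tail into an upper one.\<close>
    using assms by (subst lborel_integral_real_affine[where c = "- \<sigma>" and t = m]) auto
  also have "\<dots> = (\<integral>x. (normal_density m \<sigma> (m - \<sigma> * x) * \<sigma>) * indicator {..<a} (m - \<sigma> * x) \<partial>lborel)"
    by (subst integral_mult_right_zero[symmetric]) (simp add: mult_ac)
  also have "\<dots> = (\<integral>x. std_normal_density x * indicator {(m - a) / \<sigma><..} x \<partial>lborel)"
    using assms normal_density_affine_std(2)[OF assms]
    by (intro Bochner_Integration.integral_cong) (auto simp: indicator_def field_simps)
  finally show ?thesis by (simp add: Q_fun_greaterThan)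
qed

lemma normal_mass_Icc:
  assumes "0 < \<sigma>" "a \<le> b"
  shows "(\<integral>y. normal_density m \<sigma> y * indicator {a..b} y \<partial>lborel)
    = 1 - Q_fun ((m - a) / \<sigma>) - Q_fun ((b - m) / \<sigma>)"
proof -
  have [simp]: "integrable lborel (\<lambda>y. normal_density m \<sigma> y * indicator A y)"
    if "A \<in> sets borel" for A
    using assms that by (intro integrable_mult_indicator_right) auto
  have "1 = (\<integral>y. normal_density m \<sigma> y * indicator {..<a} y + normal_density m \<sigma> y * indicator {a..b} y
      + normal_density m \<sigma> y * indicator {b<..} y \<partial>lborel)"
    unfolding integral_normal_density[OF assms(1), of m, symmetric]
    using assms(2) by (intro Bochner_Integration.integral_cong) (auto simp: indicator_def)
  then show ?thesis
    using assms(1) by (simp add: normal_upper_tail normal_lower_tail)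
qed

text \<open>The degenerate interval \<open>{0..0}\<close> is null, while
  \<open>normal_mass_Icc\<close> gives its mass as \<open>1 - 2 * Q_fun 0\<close>.\<close>

lemma Q_fun_0: "Q_fun 0 = 1 / 2"
proof -
  have "(\<integral>y. std_normal_density y * indicator {0..0} y \<partial>lborel) = (\<integral>y. 0 \<partial>(lborel :: real measure))"
  proof (rule integral_cong_AE)
    show "AE y in lborel. std_normal_density y * indicator {0..0} y = 0"
      using AE_lborel_singleton[of 0] by eventually_elim (auto simp: indicator_def)
  qed auto
  then show ?thesis
    using normal_mass_Icc[of 1 0 0 0] by simp
qed

section \<open>Truncated means and hinges\<close>

text \<open>Split \<open>y - a\<close> as \<open>(y - m) + (m - a)\<close>; Stein's identity with
  constant factor 1 turns the first summand into boundary terms.\<close>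

lemma normal_truncated_mean:
  assumes \<sigma>: "0 < \<sigma>" and "a \<le> b"
  shows "(\<integral>y. normal_density m \<sigma> y * (y - a) * indicator {a..b} y \<partial>lborel)
    = \<sigma>\<^sup>2 * (normal_density m \<sigma> a - normal_density m \<sigma> b)
      + (m - a) * (\<integral>y. normal_density m \<sigma> y * indicator {a..b} y \<partial>lborel)"
proof -
  let ?g = "\<lambda>y. normal_density m \<sigma> y * ((y - m) * (1 + 0 * y) - \<sigma>\<^sup>2 * 0) * indicator {a..b} y"
  have "integrable lborel ?g" "integrable lborel (\<lambda>y. normal_density m \<sigma> y * indicator {a..b} y)"
    using \<sigma> by (intro integrable_mult_indicator_right stein_integrable integrable_normal_density; simp)+
  then have "(\<integral>y. ?g y + (m - a) * (normal_density m \<sigma> y * indicator {a..b} y) \<partial>lborel)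
      = integral\<^sup>L lborel ?g + (m - a) * (\<integral>y. normal_density m \<sigma> y * indicator {a..b} y \<partial>lborel)"
    by simp
  also have "integral\<^sup>L lborel ?g = \<sigma>\<^sup>2 * (normal_density m \<sigma> a - normal_density m \<sigma> b)"
    unfolding stein_Icc[OF assms] by simp
  finally show ?thesis
    by (simp add: algebra_simps)
qed

lemma normal_density_scaled:
  assumes "0 < \<sigma>"
  shows "\<sigma>\<^sup>2 * normal_density m \<sigma> y = \<sigma> / sqrt (2 * pi) * exp (- ((y - m)\<^sup>2 / (2 * \<sigma>\<^sup>2)))"
  using assms by (simp add: normal_density_def real_sqrt_mult power2_eq_square)

lemma integrable_normal_hinge:
  assumes \<sigma>: "0 < \<sigma>" and H: "0 \<le> H"
  shows "integrable lborel (\<lambda>y. normal_density m \<sigma> y * max (y - H) 0 * indicator {0..B} y)"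
proof (rule Bochner_Integration.integrable_bound)
  show "integrable lborel (\<lambda>y. \<bar>B\<bar> * normal_density m \<sigma> y)"
    using \<sigma> by simp
  show "AE y in lborel. norm (normal_density m \<sigma> y * max (y - H) 0 * indicator {0..B} y)
      \<le> norm (\<bar>B\<bar> * normal_density m \<sigma> y)"
  proof (rule AE_I2)
    fix y
    have "\<bar>max (y - H) 0 * indicator {0..B} y\<bar> \<le> \<bar>B\<bar>"
      using H by (auto simp: indicator_def)
    then have "\<bar>max (y - H) 0 * indicator {0..B} y\<bar> * normal_density m \<sigma> y \<le> \<bar>B\<bar> * normal_density m \<sigma> y"
      by (rule mult_right_mono) simp
    then show "norm (normal_density m \<sigma> y * max (y - H) 0 * indicator {0..B} y)
        \<le> norm (\<bar>B\<bar> * normal_density m \<sigma> y)"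
      by (simp add: abs_mult mult_ac)
  qed
qed measurable

text \<open>The hinge restricts the integral to \<open>[H, B]\<close>, where the truncated mean
  formula applies. The mass multiplying \<open>m - H\<close> lies in \<open>[0, 1]\<close>; in the
  boundary term the exponential at \<open>H\<close> is at most 1 and the one at \<open>B\<close> is
  estimated by \<open>(B - m)\<^sup>2 \<le> B\<^sup>2\<close>.\<close>

lemma normal_hinge_le:
  assumes \<sigma>: "0 < \<sigma>" and H: "0 \<le> H" "H \<le> B" and m: "0 \<le> m" "m \<le> B"
  shows "(\<integral>y. normal_density m \<sigma> y * max (y - H) 0 * indicator {0..B} y \<partial>lborel)
    \<le> max (m - H) 0 + \<sigma> / sqrt (2 * pi) * (1 - exp (- (B\<^sup>2 / (2 * \<sigma>\<^sup>2))))"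
proof -
  let ?N = "normal_density m \<sigma>"
  let ?I = "\<integral>y. ?N y * indicator {H..B} y \<partial>lborel"
  have "(\<integral>y. ?N y * max (y - H) 0 * indicator {0..B} y \<partial>lborel)
      = (\<integral>y. ?N y * (y - H) * indicator {H..B} y \<partial>lborel)"
    using H by (intro Bochner_Integration.integral_cong) (auto simp: indicator_def)
  also have "\<dots> = \<sigma>\<^sup>2 * (?N H - ?N B) + (m - H) * ?I"
    using \<sigma> H(2) by (rule normal_truncated_mean)
  also have "(m - H) * ?I \<le> max (m - H) 0"
  proof -
    have I0: "0 \<le> ?I" by (intro integral_nonneg_AE) simp
    have "?I \<le> (\<integral>y. ?N y \<partial>lborel)"
    proof (rule integral_mono)
      show "integrable lborel (\<lambda>y. ?N y * indicator {H..B} y)"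
        using \<sigma> by (intro integrable_mult_indicator_right) auto
    qed (use \<sigma> in \<open>auto simp: indicator_def\<close>)
    then have I1: "?I \<le> 1" using \<sigma> by simp
    have "(m - H) * ?I \<le> max (m - H) 0 * ?I" using I0 by (intro mult_right_mono) auto
    also have "\<dots> \<le> max (m - H) 0" using I1 I0 by (intro mult_right_le_one_le) auto
    finally show ?thesis .
  qed
  also have "\<sigma>\<^sup>2 * (?N H - ?N B) \<le> \<sigma> / sqrt (2 * pi) * (1 - exp (- (B\<^sup>2 / (2 * \<sigma>\<^sup>2))))"
  proof -
    have "(B - m)\<^sup>2 \<le> B\<^sup>2" using m by (intro power_mono) auto
    then have "(B - m)\<^sup>2 / (2 * \<sigma>\<^sup>2) \<le> B\<^sup>2 / (2 * \<sigma>\<^sup>2)" by (rule divide_right_mono) simp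
    moreover have "0 \<le> (H - m)\<^sup>2 / (2 * \<sigma>\<^sup>2)" by simp
    ultimately have "exp (- ((H - m)\<^sup>2 / (2 * \<sigma>\<^sup>2))) - exp (- ((B - m)\<^sup>2 / (2 * \<sigma>\<^sup>2)))
        \<le> 1 - exp (- (B\<^sup>2 / (2 * \<sigma>\<^sup>2)))"
      by (intro diff_mono) auto
    then have "\<sigma> / sqrt (2 * pi) * (exp (- ((H - m)\<^sup>2 / (2 * \<sigma>\<^sup>2))) - exp (- ((B - m)\<^sup>2 / (2 * \<sigma>\<^sup>2))))
        \<le> \<sigma> / sqrt (2 * pi) * (1 - exp (- (B\<^sup>2 / (2 * \<sigma>\<^sup>2))))"
      using \<sigma> by (intro mult_left_mono) auto
    then show ?thesis
      by (simp add: right_diff_distrib normal_density_scaled[OF \<sigma>])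
  qed
  finally show ?thesis by simp
qed

text \<open>The part of \<open>y\<close> outside \<open>[0, 1 + \<delta>]\<close> is monotone in \<open>y\<close>, so translating the mean from \<open>m\<close> up
  to \<open>1\<close> can only decrease the truncated mean minus \<open>m\<close>.\<close>

lemma normal_truncated_mean_ge:
  assumes \<sigma>: "0 < \<sigma>" and \<delta>: "0 < \<delta>" and m: "m \<le> 1"
  shows "m + (\<sigma> * (std_normal_density (1 / \<sigma>) - std_normal_density (\<delta> / \<sigma>))
      - (Q_fun (1 / \<sigma>) + Q_fun (\<delta> / \<sigma>)))
    \<le> (\<integral>y. normal_density m \<sigma> y * max (y - 0) 0 * indicator {0..1 + \<delta>} y \<partial>lborel)"
proof -
  define w where "w y = y * indicator {0..1 + \<delta>} y" for y :: real
  have [measurable]: "w \<in> borel_measurable borel"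
    unfolding w_def[abs_def] by measurable
  have int: "integrable lborel (\<lambda>y. normal_density m \<sigma> y * w y)" for m
    using integrable_normal_hinge[OF \<sigma> order_refl, of m "1 + \<delta>"]
    by (rule back_subst[where P = "integrable lborel"]) (auto simp: w_def indicator_def)
  \<comment> \<open>The density has mass 1, so \<open>m\<close> can be moved under the integral.
    After the translation all means share one density and only the integrand depends on
    \<open>m\<close>.\<close>
  have shift: "(\<integral>y. normal_density m \<sigma> y * w y \<partial>lborel) - m
      = (\<integral>z. normal_density 0 \<sigma> z * (w (m + z) - m) \<partial>lborel)"
    and int_shift: "integrable lborel (\<lambda>z. normal_density 0 \<sigma> z * (w (m + z) - m))" for m
  proof -
    have i: "integrable lborel (\<lambda>z. normal_density 0 \<sigma> z * w (m + z))"
      using lborel_integrable_real_affine[OF int[of m], of 1 m] by (simp add: normal_density_shift)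
    then show "integrable lborel (\<lambda>z. normal_density 0 \<sigma> z * (w (m + z) - m))"
      using \<sigma> by (simp add: right_diff_distrib)
    have "(\<integral>y. normal_density m \<sigma> y * w y \<partial>lborel) = (\<integral>z. normal_density 0 \<sigma> z * w (m + z) \<partial>lborel)"
      by (subst lborel_integral_real_affine[where c = 1 and t = m]) (simp_all add: normal_density_shift)
    then show "(\<integral>y. normal_density m \<sigma> y * w y \<partial>lborel) - m
        = (\<integral>z. normal_density 0 \<sigma> z * (w (m + z) - m) \<partial>lborel)"
      using i \<sigma> by (simp add: right_diff_distrib)
  qed
  have "(\<integral>y. normal_density 1 \<sigma> y * w y \<partial>lborel) - 1 \<le> (\<integral>y. normal_density m \<sigma> y * w y \<partial>lborel) - m"
    unfolding shift
  proof (rule integral_mono[OF int_shift int_shift])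
    fix z :: real
    have "w (1 + z) - 1 \<le> w (m + z) - m"
      using m \<delta> by (auto simp: w_def indicator_def)
    then show "normal_density 0 \<sigma> z * (w (1 + z) - 1) \<le> normal_density 0 \<sigma> z * (w (m + z) - m)"
      by (rule mult_left_mono) simp
  qed
  \<comment> \<open>At mean 1 the distances to the end points 0 and \<open>1 + \<delta>\<close> are
    1 and \<open>\<delta>\<close>, the two arguments in the claim before scaling by
    \<open>\<sigma>\<close>.\<close>
  moreover have "(\<integral>y. normal_density 1 \<sigma> y * w y \<partial>lborel)
      = \<sigma>\<^sup>2 * (normal_density 1 \<sigma> 0 - normal_density 1 \<sigma> (1 + \<delta>)) + (1 - Q_fun (1 / \<sigma>) - Q_fun (\<delta> / \<sigma>))"
    using normal_truncated_mean[OF \<sigma>, of 0 "1 + \<delta>" 1] normal_mass_Icc[OF \<sigma>, of 0 "1 + \<delta>" 1] \<delta>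
    by (simp add: w_def mult.assoc)
  moreover have "\<sigma>\<^sup>2 * normal_density 1 \<sigma> 0 = \<sigma> * std_normal_density (1 / \<sigma>)"
    "\<sigma>\<^sup>2 * normal_density 1 \<sigma> (1 + \<delta>) = \<sigma> * std_normal_density (\<delta> / \<sigma>)"
    unfolding normal_density_scaled[OF \<sigma>] by (simp_all add: std_normal_density_def power_divide)
  moreover have "(\<integral>y. normal_density m \<sigma> y * max (y - 0) 0 * indicator {0..1 + \<delta>} y \<partial>lborel)
      = (\<integral>y. normal_density m \<sigma> y * w y \<partial>lborel)"
    by (intro Bochner_Integration.integral_cong) (auto simp: w_def indicator_def)
  ultimately show ?thesis
    by (simp add: right_diff_distrib)
qed

subsection \<open>The auxiliary output density\<close>

text \<open>The summand \<open>- 1\<close> in the exponent is the source of the factor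
  \<open>exp 1\<close> under the root.\<close>

lemma normal_tail_exp:
  assumes "0 < \<sigma>"
  shows "exp (- (((y - b)\<^sup>2 / \<sigma>\<^sup>2 - 1) / 2))
    = sqrt (2 * pi * exp 1) * \<sigma> * normal_density b \<sigma> y"
proof -
  have "exp (- (((y - b)\<^sup>2 / \<sigma>\<^sup>2 - 1) / 2)) = exp (1 / 2) * exp (- (y - b)\<^sup>2 / (2 * \<sigma>\<^sup>2))"
    by (simp add: exp_add[symmetric] field_simps)
  moreover have "sqrt (exp 1) = exp (1 / 2 :: real)"
    by (rule real_sqrt_unique) (auto simp: exp_double[symmetric])
  ultimately show ?thesis
    using assms by (simp add: normal_density_def real_sqrt_mult)
qed

text \<open>Negative logarithm of the unnormalised auxiliary output density. The \<open>- 1\<close>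
  offsets the variance contribution of the tails: it enlarges the mass, but keeps the mean of the
  tail exponents at most 0 for Gaussian means in \<open>[0, B]\<close>.\<close>

definition aux_exponent :: "real \<Rightarrow> real \<Rightarrow> (real \<Rightarrow> real) \<Rightarrow> real \<Rightarrow> real" where
  "aux_exponent \<sigma> B \<psi> y =
    (if y < 0 then (y\<^sup>2 / \<sigma>\<^sup>2 - 1) / 2 else if y \<le> B then \<psi> y else ((y - B)\<^sup>2 / \<sigma>\<^sup>2 - 1) / 2)"

lemma measurable_aux_exponent [measurable]:
  assumes [measurable]: "\<psi> \<in> borel_measurable borel"
  shows "aux_exponent \<sigma> B \<psi> \<in> borel_measurable borel"
  unfolding aux_exponent_def[abs_def] by measurable

text \<open>Each outer piece is half of a Gaussian centred at its cut point, so the two together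
  contribute one full \<open>?K\<close>. The bound \<open>C\<close> is what makes the middle piece
  integrable.\<close>

lemma has_integral_exp_aux_exponent:
  assumes \<sigma>: "0 < \<sigma>" and B: "0 \<le> B" and [measurable]: "\<psi> \<in> borel_measurable borel"
    and C: "\<And>y. y \<in> {0..B} \<Longrightarrow> \<bar>\<psi> y\<bar> \<le> C"
  shows "has_bochner_integral lborel (\<lambda>y. exp (- aux_exponent \<sigma> B \<psi> y))
    ((LBINT y:{0..B}. exp (- \<psi> y)) + sqrt (2 * pi * exp 1) * \<sigma>)"
proof -
  let ?K = "sqrt (2 * pi * exp 1) * \<sigma>"
  have eq: "exp (- aux_exponent \<sigma> B \<psi> y) = exp (- \<psi> y) * indicator {0..B} y
      + ?K * (normal_density 0 \<sigma> y * indicator {..<0} y)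
      + ?K * (normal_density B \<sigma> y * indicator {B<..} y)" for y
    using B normal_tail_exp[OF \<sigma>, of y 0] normal_tail_exp[OF \<sigma>, of y B]
    by (auto simp: aux_exponent_def indicator_def)
  have "integrable lborel (\<lambda>y. exp C * indicator {0..B} y)"
    by (intro integrable_mult_right integrable_real_indicator) (auto simp: emeasure_lborel_Icc_eq)
  then have "integrable lborel (\<lambda>y. exp (- \<psi> y) * indicator {0..B} y)"
    by (rule Bochner_Integration.integrable_bound)
       (use C in \<open>auto simp: indicator_def abs_le_iff intro!: AE_I2\<close>)
  then have mid: "has_bochner_integral lborel (\<lambda>y. exp (- \<psi> y) * indicator {0..B} y) (LBINT y:{0..B}. exp (- \<psi> y))"
    by (simp add: has_bochner_integral_iff set_lebesgue_integral_def mult.commute)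
  have N: "integrable lborel (\<lambda>y. normal_density m \<sigma> y * indicator A y)" if "A \<in> sets borel" for A m
    using \<sigma> that by (intro integrable_mult_indicator_right) auto
  have lower: "has_bochner_integral lborel (\<lambda>y. normal_density 0 \<sigma> y * indicator {..<0} y) (1 / 2)"
    using \<sigma> N by (simp add: has_bochner_integral_iff normal_lower_tail Q_fun_0)
  have upper: "has_bochner_integral lborel (\<lambda>y. normal_density B \<sigma> y * indicator {B<..} y) (1 / 2)"
    using \<sigma> N by (simp add: has_bochner_integral_iff normal_upper_tail Q_fun_0)
  have "(LBINT y:{0..B}. exp (- \<psi> y)) + ?K * (1 / 2) + ?K * (1 / 2) = (LBINT y:{0..B}. exp (- \<psi> y)) + ?K"
    by simp
  then show ?thesis
    unfolding eq
    by (metis (no_types) has_bochner_integral_add[OF has_bochner_integral_add[OF mid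
          has_bochner_integral_mult_right[OF lower]] has_bochner_integral_mult_right[OF upper]])
qed

text \<open>A quadratic majorant in \<open>y - m\<close> whose coefficients do not depend on
  \<open>m\<close>; it later dominates the log-ratio uniformly over the inputs.\<close>

lemma abs_aux_exponent_le:
  assumes \<sigma>: "0 < \<sigma>" and B: "0 \<le> B" and C: "\<And>y. y \<in> {0..B} \<Longrightarrow> \<bar>\<psi> y\<bar> \<le> C"
    and m: "0 \<le> m" "m \<le> B"
  shows "\<bar>aux_exponent \<sigma> B \<psi> y\<bar> \<le> C + 1 + 2 * B\<^sup>2 / \<sigma>\<^sup>2 + 2 / \<sigma>\<^sup>2 * (y - m)\<^sup>2"
proof -
  have C0: "0 \<le> C" using C[of 0] B by auto
  \<comment> \<open>Covers both tails, with \<open>u = y\<^sup>2\<close> below 0 and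
    \<open>u = (y - B)\<^sup>2\<close> above \<open>B\<close>.\<close>
  have q: "\<bar>(u / \<sigma>\<^sup>2 - 1) / 2\<bar> \<le> 1 + y\<^sup>2 / \<sigma>\<^sup>2" if "0 \<le> u" "u \<le> y\<^sup>2" for u
  proof -
    have "0 \<le> u / \<sigma>\<^sup>2" "u / \<sigma>\<^sup>2 \<le> y\<^sup>2 / \<sigma>\<^sup>2"
      using that by (auto intro: divide_right_mono)
    then show ?thesis unfolding abs_le_iff by (simp add: field_simps)
  qed
  have "\<bar>aux_exponent \<sigma> B \<psi> y\<bar> \<le> C + 1 + y\<^sup>2 / \<sigma>\<^sup>2"
  proof -
    consider "y < 0" | "0 \<le> y" "y \<le> B" | "B < y" by linarith
    then show ?thesis
    proof cases
      case 1
      then show ?thesis using q[of "y\<^sup>2"] C0 by (simp add: aux_exponent_def)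
    next
      case 2
      have "0 \<le> y\<^sup>2 / \<sigma>\<^sup>2" by simp
      moreover have "aux_exponent \<sigma> B \<psi> y = \<psi> y" using 2 by (simp add: aux_exponent_def)
      moreover have "\<bar>\<psi> y\<bar> \<le> C" using C 2 by simp
      ultimately show ?thesis by linarith
    next
      case 3
      then have "(y - B)\<^sup>2 \<le> y\<^sup>2" using B by (intro power_mono) auto
      then show ?thesis using q[of "(y - B)\<^sup>2"] 3 B C0 by (simp add: aux_exponent_def)
    qed
  qed
  \<comment> \<open>\<open>2 * (y - m)\<^sup>2 + 2 * m\<^sup>2 - y\<^sup>2\<close> is the square of
    \<open>y - 2 * m\<close>.\<close>
  also have "y\<^sup>2 \<le> 2 * (y - m)\<^sup>2 + 2 * B\<^sup>2"
  proof -
    have "m\<^sup>2 \<le> B\<^sup>2" using m by (intro power_mono) auto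
    moreover have "0 \<le> (y - 2 * m)\<^sup>2" by simp
    ultimately show ?thesis by (simp add: power2_eq_square algebra_simps)
  qed
  then have "y\<^sup>2 / \<sigma>\<^sup>2 \<le> (2 * (y - m)\<^sup>2 + 2 * B\<^sup>2) / \<sigma>\<^sup>2"
    by (rule divide_right_mono) simp
  finally show ?thesis by (simp add: add_divide_distrib)
qed

text \<open>Outside \<open>[0, B]\<close> the square is compared with \<open>(y - m) * y\<close> and \<open>(y - m) * (y - B)\<close>,
  whose Gaussian tail integrals equal \<open>\<sigma>\<^sup>2\<close> times the tail mass by parts.\<close>

lemma integral_normal_aux_exponent_le:
  assumes \<sigma>: "0 < \<sigma>" and m: "0 \<le> m" "m \<le> B"
    and int: "integrable lborel (\<lambda>y. normal_density m \<sigma> y * aux_exponent \<sigma> B \<psi> y)"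
    and int': "integrable lborel (\<lambda>y. normal_density m \<sigma> y * \<psi> y * indicator {0..B} y)"
  shows "(\<integral>y. normal_density m \<sigma> y * aux_exponent \<sigma> B \<psi> y \<partial>lborel)
    \<le> (\<integral>y. normal_density m \<sigma> y * \<psi> y * indicator {0..B} y \<partial>lborel)"
proof -
  let ?N = "normal_density m \<sigma>"
  let ?L = "\<lambda>y. ?N y * ((y - m) * (0 + 1 * y) - \<sigma>\<^sup>2 * 1) * indicator {..<0} y"
  let ?U = "\<lambda>y. ?N y * ((y - m) * (- B + 1 * y) - \<sigma>\<^sup>2 * 1) * indicator {B<..} y"
  have int_L: "integrable lborel ?L" and int_U: "integrable lborel ?U"
    using \<sigma> by (intro integrable_mult_indicator_right stein_integrable; simp)+
  have "(\<integral>y. ?N y * aux_exponent \<sigma> B \<psi> y \<partial>lborel)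
      \<le> (\<integral>y. ?N y * \<psi> y * indicator {0..B} y + (?L y / (2 * \<sigma>\<^sup>2) + ?U y / (2 * \<sigma>\<^sup>2)) \<partial>lborel)"
  proof (rule integral_mono[OF int])
    fix y
    consider "y < 0" | "0 \<le> y" "y \<le> B" | "B < y" by linarith
    then show "?N y * aux_exponent \<sigma> B \<psi> y
        \<le> ?N y * \<psi> y * indicator {0..B} y + (?L y / (2 * \<sigma>\<^sup>2) + ?U y / (2 * \<sigma>\<^sup>2))"
    proof cases
      case 1
      then have "m * y \<le> 0" using m by (simp add: mult_nonneg_nonpos)
      then have "(y\<^sup>2 - \<sigma>\<^sup>2) / (2 * \<sigma>\<^sup>2) \<le> ((y - m) * y - \<sigma>\<^sup>2) / (2 * \<sigma>\<^sup>2)"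
        by (intro divide_right_mono) (auto simp: power2_eq_square algebra_simps)
      then have "?N y * ((y\<^sup>2 - \<sigma>\<^sup>2) / (2 * \<sigma>\<^sup>2)) \<le> ?N y * (((y - m) * y - \<sigma>\<^sup>2) / (2 * \<sigma>\<^sup>2))"
        by (rule mult_left_mono) simp
      moreover have "aux_exponent \<sigma> B \<psi> y = (y\<^sup>2 - \<sigma>\<^sup>2) / (2 * \<sigma>\<^sup>2)"
        using 1 \<sigma> by (simp add: aux_exponent_def field_simps)
      ultimately show ?thesis using 1 m by simp
    next
      case 2
      then show ?thesis by (simp add: aux_exponent_def)
    next
      case 3
      have "(m - B) * (y - B) \<le> 0" using 3 m by (intro mult_nonpos_nonneg) auto
      then have "((y - B)\<^sup>2 - \<sigma>\<^sup>2) / (2 * \<sigma>\<^sup>2) \<le> ((y - m) * (y - B) - \<sigma>\<^sup>2) / (2 * \<sigma>\<^sup>2)"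
        by (intro divide_right_mono) (auto simp: power2_eq_square algebra_simps)
      then have "?N y * (((y - B)\<^sup>2 - \<sigma>\<^sup>2) / (2 * \<sigma>\<^sup>2)) \<le> ?N y * (((y - m) * (y - B) - \<sigma>\<^sup>2) / (2 * \<sigma>\<^sup>2))"
        by (rule mult_left_mono) simp
      moreover have "aux_exponent \<sigma> B \<psi> y = ((y - B)\<^sup>2 - \<sigma>\<^sup>2) / (2 * \<sigma>\<^sup>2)"
        using 3 m \<sigma> by (simp add: aux_exponent_def field_simps)
      ultimately show ?thesis using 3 m by simp
    qed
  qed (use int' int_L int_U in simp)
  also have "\<dots> = (\<integral>y. ?N y * \<psi> y * indicator {0..B} y \<partial>lborel)"
  proof -
    \<comment> \<open>The affine factors \<open>y\<close> and \<open>y - B\<close> vanish at their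
      cut points, so no boundary terms survive.\<close>
    have "integral\<^sup>L lborel ?L = 0" "integral\<^sup>L lborel ?U = 0"
      unfolding stein_lessThan[OF \<sigma>] stein_greaterThan[OF \<sigma>] by simp_all
    then show ?thesis
      by (subst Bochner_Integration.integral_add
            Bochner_Integration.integral_add[of lborel "\<lambda>y. ?L y / (2 * \<sigma>\<^sup>2)"],
          use int' int_L int_U in simp_all)+
  qed
  finally show ?thesis .
qed

section \<open>Bound for a single input law\<close>

text \<open>The log-ratio splits into the constant \<open>l\<close>, a quadratic of Gaussian mean 0,
  and the auxiliary exponent, whose conditional mean is at most that of \<open>\<psi>\<close> on
  \<open>[0, B]\<close> and hence at most \<open>\<kappa> x\<close>.\<close>

lemma auxiliary_output_bound:
  fixes n :: nat and h :: "nat \<Rightarrow> real" and \<psi> :: "real \<Rightarrow> real"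
  defines "s \<equiv> \<lambda>x. \<Sum>k = 1..n. h k * x k"
  assumes "prob_space \<mu>" and sets_mu: "sets \<mu> = sets (input_space n)"
    and \<sigma>: "0 < \<sigma>" and B: "0 \<le> B" and \<psi>_meas: "\<psi> \<in> borel_measurable borel"
    and C: "\<And>y. y \<in> {0..B} \<Longrightarrow> \<bar>\<psi> y\<bar> \<le> C"
    and s_range: "AE x in \<mu>. 0 \<le> s x \<and> s x \<le> B"
    and \<kappa>: "integrable \<mu> \<kappa>"
    and \<kappa>_bound: "AE x in \<mu>. (\<integral>y. normal_density (s x) \<sigma> y * \<psi> y * indicator {0..B} y \<partial>lborel) \<le> \<kappa> x"
  shows "channel_mutual_information n h \<sigma> \<mu>
    \<le> ln (1 + (LBINT y:{0..B}. exp (- \<psi> y)) / (sqrt (2 * pi * exp 1) * \<sigma>)) + (\<integral>x. \<kappa> x \<partial>\<mu>)"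
proof -
  interpret mu: prob_space \<mu> by fact
  interpret ml: pair_sigma_finite \<mu> lborel ..
  note [measurable_cong] = sets_mu
  note [measurable] = \<psi>_meas
  have [measurable]: "s \<in> borel_measurable \<mu>"
    unfolding s_def by measurable
  define K where "K = sqrt (2 * pi * exp 1) * \<sigma>"
  define P where "P = (LBINT y:{0..B}. exp (- \<psi> y))"
  define g where "g = aux_exponent \<sigma> B \<psi>"
  define r where "r y = exp (- g y) / (P + K)" for y
  define N where "N x y = normal_density (s x) \<sigma> y" for x y
  have [measurable]: "g \<in> borel_measurable borel"
    unfolding g_def by measurable
  have K: "0 < K" using \<sigma> by (simp add: K_def)
  have P: "0 \<le> P"
    unfolding P_def set_lebesgue_integral_def by (intro integral_nonneg_AE) auto
  have N_pos: "0 < N x y" for x y using \<sigma> by (simp add: N_def normal_density_pos)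
  have r_pos: "0 < r y" for y using K P by (simp add: r_def)
  have r_int: "has_bochner_integral lborel r 1"
    using has_bochner_integral_divide_zero[OF has_integral_exp_aux_exponent[OF \<sigma> B \<psi>_meas C], of "P + K"] K P
    by (simp add: r_def[abs_def] g_def P_def K_def)
  define l where "l = ln (1 + P / K)"
  define T where "T x y = l + (1 - (y - s x)\<^sup>2 / \<sigma>\<^sup>2) / 2 + g y" for x y
  have log_ratio: "ln (N x y / r y) = T x y" for x y
  proof -
    have "ln (N x y) = - ln (sqrt (2 * pi) * \<sigma>) - (y - s x)\<^sup>2 / (2 * \<sigma>\<^sup>2)"
      using \<sigma> by (simp add: N_def normal_density_def ln_mult ln_div real_sqrt_mult)
    moreover have "ln (r y) = - g y - ln (P + K)"
      using K P by (simp add: r_def ln_div)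
    moreover have "ln (P + K) = ln K + l"
    proof -
      have "P + K = K * (1 + P / K)" using K by (simp add: field_simps)
      moreover have "0 < 1 + P / K" using K P by (simp add: add_pos_nonneg)
      ultimately show ?thesis unfolding l_def using K by (metis ln_mult_pos)
    qed
    \<comment> \<open>The factor \<open>exp 1\<close> supplies the \<open>1 / 2\<close> that centres
      the quadratic part of \<open>T\<close>.\<close>
    moreover have "ln K = ln (sqrt (2 * pi) * \<sigma>) + 1 / 2"
      using \<sigma> by (simp add: K_def real_sqrt_mult ln_mult ln_sqrt)
    moreover have "ln (N x y / r y) = ln (N x y) - ln (r y)"
      using N_pos[of x y] r_pos[of y] by (simp add: ln_div)
    ultimately show ?thesis by (simp add: T_def field_simps)
  qed
  \<comment> \<open>\<open>c\<close> collects the constants of the majorant; \<open>d\<close> adds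
    the quadratic coefficients \<open>1 / (2 * \<sigma>\<^sup>2)\<close> of the Gaussian exponent
    and \<open>2 / \<sigma>\<^sup>2\<close> of \<open>abs_aux_exponent_le\<close>.\<close>
  define c where "c = \<bar>l\<bar> + 1 / 2 + (C + 1 + 2 * B\<^sup>2 / \<sigma>\<^sup>2)"
  define d where "d = 5 / (2 * \<sigma>\<^sup>2)"
  have NT_le: "\<bar>N x y * T x y\<bar> \<le> N x y * (c + d * (y - s x)\<^sup>2)" if "0 \<le> s x" "s x \<le> B" for x y
  proof -
    have "\<bar>T x y\<bar> \<le> \<bar>l\<bar> + (1 / 2 + (y - s x)\<^sup>2 / (2 * \<sigma>\<^sup>2)) + \<bar>g y\<bar>"
    proof -
      have "0 \<le> (y - s x)\<^sup>2 / (2 * \<sigma>\<^sup>2)" by simp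
      moreover have "(1 - (y - s x)\<^sup>2 / \<sigma>\<^sup>2) / 2 = 1 / 2 - (y - s x)\<^sup>2 / (2 * \<sigma>\<^sup>2)"
        by (simp add: diff_divide_distrib)
      moreover have "\<bar>l + (1 / 2 - u) + g y\<bar> \<le> \<bar>l\<bar> + (1 / 2 + u) + \<bar>g y\<bar>" if "0 \<le> u" for u
        using that by linarith
      ultimately show ?thesis unfolding T_def by presburger
    qed
    also have "\<bar>g y\<bar> \<le> C + 1 + 2 * B\<^sup>2 / \<sigma>\<^sup>2 + 2 / \<sigma>\<^sup>2 * (y - s x)\<^sup>2"
      unfolding g_def using \<sigma> B C that by (rule abs_aux_exponent_le)
    also have "\<bar>l\<bar> + (1 / 2 + (y - s x)\<^sup>2 / (2 * \<sigma>\<^sup>2)) + (C + 1 + 2 * B\<^sup>2 / \<sigma>\<^sup>2 + 2 / \<sigma>\<^sup>2 * (y - s x)\<^sup>2)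
        = c + d * (y - s x)\<^sup>2"
      using \<sigma> by (simp add: c_def d_def field_simps)
    finally show ?thesis
      using N_pos[of x y] by (simp add: abs_mult)
  qed
  \<comment> \<open>The value is free of \<open>x\<close>, which gives joint integrability through
    Fubini.\<close>
  have bound: "has_bochner_integral lborel (\<lambda>y. N x y * (c + d * (y - s x)\<^sup>2)) (c + d * \<sigma>\<^sup>2)" for x
  proof -
    have "has_bochner_integral lborel (\<lambda>y. c * N x y + d * (N x y * (y - s x) ^ (2 * 1)))
        (c * 1 + d * (fact (2 * 1) / ((2 / \<sigma>\<^sup>2) ^ 1 * fact 1)))"
      unfolding N_def using \<sigma>
      by (intro has_bochner_integral_add has_bochner_integral_mult_right normal_moment_even)
         (simp_all add: has_bochner_integral_iff)
    moreover have "c * N x y + d * (N x y * (y - s x) ^ (2 * 1)) = N x y * (c + d * (y - s x)\<^sup>2)" for y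
      by (simp add: distrib_left)
    ultimately show ?thesis
      by simp
  qed
  have NT_meas[measurable]: "(\<lambda>(x, y). N x y * T x y) \<in> borel_measurable (\<mu> \<Otimes>\<^sub>M lborel)"
    unfolding N_def T_def split_beta' by measurable
  have NT_meas_y[measurable]: "(\<lambda>y. N x y * T x y) \<in> borel_measurable lborel" for x
    unfolding N_def T_def by measurable
  have NT_int: "integrable lborel (\<lambda>y. N x y * T x y)" if "0 \<le> s x" "s x \<le> B" for x
    by (rule Bochner_Integration.integrable_bound[OF integrable.intros[OF bound[of x]]])
       (use NT_le[OF that] in \<open>auto intro!: AE_I2 order_trans[OF _ abs_ge_self]\<close>)
  have NT_abs: "(\<integral>y. \<bar>N x y * T x y\<bar> \<partial>lborel) \<le> c + d * \<sigma>\<^sup>2" if "0 \<le> s x" "s x \<le> B" for x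
  proof -
    have "(\<integral>y. \<bar>N x y * T x y\<bar> \<partial>lborel) \<le> (\<integral>y. N x y * (c + d * (y - s x)\<^sup>2) \<partial>lborel)"
      using NT_int[OF that] integrable.intros[OF bound[of x]] NT_le[OF that]
      by (intro integral_mono) auto
    then show ?thesis
      using has_bochner_integral_integral_eq[OF bound[of x]] by simp
  qed
  have int: "integrable (\<mu> \<Otimes>\<^sub>M lborel) (\<lambda>(x, y). N x y * T x y)"
  proof (rule ml.Fubini_integrable)
    show "integrable \<mu> (\<lambda>x. \<integral>y. norm (case (x, y) of (x, y) \<Rightarrow> N x y * T x y) \<partial>lborel)"
    proof (rule mu.integrable_const_bound[where B = "c + d * \<sigma>\<^sup>2"])
      show "AE x in \<mu>. norm (\<integral>y. norm (case (x, y) of (x, y) \<Rightarrow> N x y * T x y) \<partial>lborel) \<le> c + d * \<sigma>\<^sup>2"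
        using s_range by eventually_elim (use NT_abs in simp)
      show "(\<lambda>x. \<integral>y. norm (case (x, y) of (x, y) \<Rightarrow> N x y * T x y) \<partial>lborel) \<in> borel_measurable \<mu>"
        by measurable
    qed
    show "AE x in \<mu>. integrable lborel (\<lambda>y. case (x, y) of (x, y) \<Rightarrow> N x y * T x y)"
      using s_range by eventually_elim (use NT_int in simp)
  qed measurable
  have inner: "(\<integral>y. N x y * T x y \<partial>lborel)
      \<le> l + (\<integral>y. N x y * \<psi> y * indicator {0..B} y \<partial>lborel)" if sx: "0 \<le> s x" "s x \<le> B" for x
  proof -
    \<comment> \<open>The second central moment is \<open>\<sigma>\<^sup>2\<close>, so the stated
      value simplifies to \<open>l\<close>.\<close>
    have v: "has_bochner_integral lborel (\<lambda>y. (l + 1 / 2) * N x y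
        - 1 / (2 * \<sigma>\<^sup>2) * (N x y * (y - s x) ^ (2 * 1)))
        ((l + 1 / 2) * 1 - 1 / (2 * \<sigma>\<^sup>2) * (fact (2 * 1) / ((2 / \<sigma>\<^sup>2) ^ 1 * fact 1)))"
      unfolding N_def using \<sigma>
      by (intro has_bochner_integral_diff has_bochner_integral_mult_right normal_moment_even)
         (simp_all add: has_bochner_integral_iff)
    have NT_eq: "N x y * T x y = ((l + 1 / 2) * N x y - 1 / (2 * \<sigma>\<^sup>2) * (N x y * (y - s x) ^ (2 * 1)))
        + N x y * g y" for y
      using \<sigma> by (simp add: T_def field_simps power2_eq_square)
    have int_g: "integrable lborel (\<lambda>y. N x y * g y)"
      using Bochner_Integration.integrable_diff[OF NT_int[OF sx] integrable.intros[OF v]]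
      by (simp add: NT_eq)
    have "integrable lborel (\<lambda>y. N x y * g y * indicator {0..B} y)"
      using int_g by (rule integrable_mult_indicator_right) simp
    moreover have "N x y * g y * indicator {0..B} y = N x y * \<psi> y * indicator {0..B} y" for y
      by (simp add: g_def aux_exponent_def indicator_def)
    ultimately have int_\<psi>: "integrable lborel (\<lambda>y. N x y * \<psi> y * indicator {0..B} y)"
      by simp
    have "(\<integral>y. N x y * T x y \<partial>lborel) = l + (\<integral>y. N x y * g y \<partial>lborel)"
      unfolding NT_eq using integrable.intros[OF v] int_g \<sigma>
      by (subst Bochner_Integration.integral_add)
         (simp_all only: has_bochner_integral_integral_eq[OF v], simp add: field_simps)
    also have "(\<integral>y. N x y * g y \<partial>lborel) \<le> (\<integral>y. N x y * \<psi> y * indicator {0..B} y \<partial>lborel)"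
      using integral_normal_aux_exponent_le[OF \<sigma> sx] int_g int_\<psi> by (simp add: N_def g_def)
    finally show ?thesis by simp
  qed
  have "channel_mutual_information n h \<sigma> \<mu> \<le> (\<integral>(x, y). N x y * T x y \<partial>(\<mu> \<Otimes>\<^sub>M lborel))"
  proof -
    have "(\<lambda>(x, y). normal_density (\<Sum>k = 1..n. h k * x k) \<sigma> y
        * ln (normal_density (\<Sum>k = 1..n. h k * x k) \<sigma> y / r y)) = (\<lambda>(x, y). N x y * T x y)"
      by (simp add: log_ratio[symmetric] N_def s_def)
    with channel_mutual_information_le[OF mu.prob_space_axioms sets_mu \<sigma> r_int r_pos, of h] int
    show ?thesis by simp
  qed
  also have "\<dots> = (\<integral>x. \<integral>y. N x y * T x y \<partial>lborel \<partial>\<mu>)"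
    using ml.integral_fst'[OF int] by simp
  also have "\<dots> \<le> (\<integral>x. l + \<kappa> x \<partial>\<mu>)"
  proof (rule integral_mono_AE)
    show "integrable \<mu> (\<lambda>x. \<integral>y. N x y * T x y \<partial>lborel)"
      using ml.integrable_fst'[OF int] by simp
    show "AE x in \<mu>. (\<integral>y. N x y * T x y \<partial>lborel) \<le> l + \<kappa> x"
      using s_range \<kappa>_bound
    proof eventually_elim
      case (elim x)
      then show ?case using inner[of x] by (simp add: N_def)
    qed
  qed (use \<kappa> in simp)
  also have "\<dots> = l + (\<integral>x. \<kappa> x \<partial>\<mu>)"
    using \<kappa> by (simp add: mu.prob_space)
  finally show ?thesis by (simp add: l_def P_def K_def)
qed

subsection \<open>The capacity bound\<close>

text \<open>As coordinates are at most 1, the first \<open>i\<close> of them contribute at most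
  \<open>H_sum h i\<close>. Hence the tail sum dominates the hinge of the noiseless output at
  \<open>H_sum h i\<close>.\<close>

lemma admissible_linear_bounds:
  assumes "\<mu> \<in> admissible_laws n \<alpha>" and h: "\<forall>k\<in>{1..n}. h k > (0 :: real)"
  shows "AE x in \<mu>. \<forall>i\<le>n. 0 \<le> (\<Sum>k = i+1..n. h k * x k)
    \<and> (\<Sum>k = i+1..n. h k * x k) \<le> (\<Sum>k = 1..n. h k * x k)
    \<and> (\<Sum>k = 1..n. h k * x k) - H_sum h i \<le> (\<Sum>k = i+1..n. h k * x k)"
proof -
  have "AE x in \<mu>. \<forall>k\<in>{1..n}. 0 \<le> x k \<and> x k \<le> 1"
    using assms(1) by (subst AE_finite_all) (auto simp: admissible_laws_def)
  then show ?thesis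
  proof (eventually_elim, intro allI impI)
    fix x :: "nat \<Rightarrow> real" and i
    assume x: "\<forall>k\<in>{1..n}. 0 \<le> x k \<and> x k \<le> 1" and i: "i \<le> n"
    have split: "(\<Sum>k = 1..n. h k * x k) = (\<Sum>k = 1..i. h k * x k) + (\<Sum>k = i+1..n. h k * x k)"
      using i sum.ub_add_nat[of 1 i "\<lambda>k. h k * x k" "n - i"] by simp
    have "0 \<le> (\<Sum>k = i+1..n. h k * x k)" "0 \<le> (\<Sum>k = 1..i. h k * x k)"
      using x h i by (auto intro!: sum_nonneg mult_nonneg_nonneg simp: less_imp_le)
    moreover have "(\<Sum>k = 1..i. h k * x k) \<le> H_sum h i"
      unfolding H_sum_def using x h i by (intro sum_mono mult_right_le_one_le) (auto simp: less_imp_le)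
    ultimately show "0 \<le> (\<Sum>k = i+1..n. h k * x k)
      \<and> (\<Sum>k = i+1..n. h k * x k) \<le> (\<Sum>k = 1..n. h k * x k)
      \<and> (\<Sum>k = 1..n. h k * x k) - H_sum h i \<le> (\<Sum>k = i+1..n. h k * x k)"
      unfolding split by linarith
  qed
qed

text \<open>Integrability of each coordinate comes from its almost sure bound, and its value from
  the mean constraint.\<close>

lemma admissible_mean:
  assumes "\<mu> \<in> admissible_laws n \<alpha>"
  shows "has_bochner_integral \<mu> (\<lambda>x. \<Sum>k = i+1..n. h k * x k) (\<Sum>k = i+1..n. h k * \<alpha> k)"
proof (intro has_bochner_integral_sum has_bochner_integral_mult_right)
  fix k assume k: "k \<in> {i+1..n}"
  interpret prob_space \<mu> using assms by (simp add: admissible_laws_def)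
  have sets: "sets \<mu> = sets (input_space n)" using assms by (simp add: admissible_laws_def)
  have "AE x in \<mu>. 0 \<le> x k \<and> x k \<le> 1"
    using assms k by (simp add: admissible_laws_def)
  then have "AE x in \<mu>. norm (x k) \<le> 1"
    by eventually_elim simp
  moreover have "(\<lambda>x. x k) \<in> borel_measurable \<mu>"
    unfolding measurable_cong_sets[OF sets refl]
    using k by (intro measurable_component_singleton) auto
  ultimately have "integrable \<mu> (\<lambda>x. x k)"
    by (rule integrable_const_bound)
  then show "has_bochner_integral \<mu> (\<lambda>x. x k) (\<alpha> k)"
    using assms k by (auto simp: admissible_laws_def has_bochner_integral_iff)
qed

text \<open>The weights after \<open>i\<close> are positive and nonempty in number. Strictness later
  allows cancelling the denominator of \<open>alpha_bar\<close>.\<close>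

lemma H_sum_range:
  assumes h: "\<forall>k\<in>{1..n}. h k > (0 :: real)" "(\<Sum>k = 1..n. h k) = 1" and i: "i < n"
  shows "0 \<le> H_sum h i" "H_sum h i < 1"
proof -
  show "0 \<le> H_sum h i"
    unfolding H_sum_def using h i by (intro sum_nonneg) (auto simp: less_imp_le)
  have "(\<Sum>k = 1..n. h k) = H_sum h i + (\<Sum>k = i+1..n. h k)"
    unfolding H_sum_def using i sum.ub_add_nat[of 1 i h "n - i"] by simp
  moreover have "0 < (\<Sum>k = i+1..n. h k)"
    using h(1) i by (intro sum_pos) auto
  ultimately show "H_sum h i < 1" using h(2) by simp
qed

text \<open>\<open>c i\<close> bounds the excess of the weighted truncated hinge mean over the weighted hinge of the
  noiseless output; the sign of \<open>lam 0\<close> only enters through the choice of \<open>c 0\<close>.\<close>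

lemma capacity_le:
  fixes n :: nat and h \<alpha> lam c :: "nat \<Rightarrow> real"
  assumes n: "n \<ge> 1" and h: "\<forall>k\<in>{1..n}. h k > 0" "(\<Sum>k = 1..n. h k) = 1"
    and \<sigma>: "0 < \<sigma>" and \<delta>: "0 < \<delta>"
    and c: "\<And>i m t. i < n \<Longrightarrow> 0 \<le> m \<Longrightarrow> m \<le> 1 \<Longrightarrow> 0 \<le> t \<Longrightarrow> m - H_sum h i \<le> t \<Longrightarrow> (i = 0 \<Longrightarrow> t = m) \<Longrightarrow>
      lam i * (\<integral>y. normal_density m \<sigma> y * max (y - H_sum h i) 0 * indicator {0..1 + \<delta>} y \<partial>lborel)
        \<le> lam i * t + c i"
  shows "EC_OIC_capacity n h \<alpha> \<sigma> \<le> ereal (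
    ln (1 + P_integral n h \<delta> lam / (sqrt (2 * pi * exp 1) * \<sigma>))
    + (\<Sum>i = 0..n - 1. lam i * (1 - H_sum h i) * alpha_bar n h \<alpha> i) + (\<Sum>i = 0..n - 1. c i))"
  unfolding EC_OIC_capacity_def
proof (rule SUP_least)
  fix \<mu> assume \<mu>: "\<mu> \<in> admissible_laws n \<alpha>"
  interpret prob_space \<mu> using \<mu> by (simp add: admissible_laws_def)
  define \<psi> where "\<psi> y = lam 0 * y + (\<Sum>i = 1..n - 1. lam i * max (y - H_sum h i) 0)" for y
  \<comment> \<open>\<open>t 0 x\<close> is the whole noiseless output and plays the role of
    \<open>m\<close> in the hypothesis on \<open>c\<close>, whence the equality there at
    \<open>i = 0\<close>.\<close>
  define t where "t i x = (\<Sum>k = i+1..n. h k * x k)" for i and x :: "nat \<Rightarrow> real"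
  define \<kappa> where "\<kappa> x = (\<Sum>i = 0..n - 1. lam i * t i x + c i)" for x
  \<comment> \<open>\<open>H_sum h 0 = 0\<close>, so on nonnegative arguments the linear term is the
    hinge with index 0.\<close>
  have \<psi>_eq: "\<psi> y = (\<Sum>i = 0..n - 1. lam i * max (y - H_sum h i) 0)" if "0 \<le> y" for y
    unfolding \<psi>_def using that by (subst (2) sum.atLeast_Suc_atMost) (auto simp: H_sum_def)
  have cont: "continuous_on UNIV \<psi>"
    unfolding \<psi>_def[abs_def] by (intro continuous_intros)
  have "compact (\<psi> ` {0..1 + \<delta>})"
    by (intro compact_continuous_image continuous_on_subset[OF cont]) auto
  then have "bounded (\<psi> ` {0..1 + \<delta>})"
    by (rule compact_imp_bounded)
  then obtain C where C: "\<forall>y\<in>{0..1 + \<delta>}. \<bar>\<psi> y\<bar> \<le> C"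
    unfolding bounded_iff by auto
  have range: "AE x in \<mu>. 0 \<le> t 0 x \<and> t 0 x \<le> 1 \<and> (\<forall>i<n. 0 \<le> t i x \<and> t 0 x - H_sum h i \<le> t i x)"
    using admissible_linear_bounds[OF \<mu> h(1)]
  proof eventually_elim
    case (elim x)
    \<comment> \<open>Index \<open>n\<close> has an empty tail sum and \<open>H_sum h n = 1\<close>,
      which bounds the output by 1.\<close>
    then show ?case
      using h(2) elim[rule_format, of n] elim[rule_format, of 0] by (auto simp: t_def H_sum_def)
  qed
  have \<kappa>: "has_bochner_integral \<mu> \<kappa> (\<Sum>i = 0..n - 1. lam i * (\<Sum>k = i+1..n. h k * \<alpha> k) + c i)"
    unfolding \<kappa>_def t_def
    by (intro has_bochner_integral_sum has_bochner_integral_add has_bochner_integral_mult_right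
        admissible_mean[OF \<mu>]) (simp add: has_bochner_integral_iff prob_space)
  have "channel_mutual_information n h \<sigma> \<mu>
    \<le> ln (1 + (LBINT y:{0..1 + \<delta>}. exp (- \<psi> y)) / (sqrt (2 * pi * exp 1) * \<sigma>)) + (\<integral>x. \<kappa> x \<partial>\<mu>)"
  proof (rule auxiliary_output_bound[OF prob_space_axioms _ \<sigma> _ _ C[rule_format]])
    show "AE x in \<mu>. 0 \<le> (\<Sum>k = 1..n. h k * x k) \<and> (\<Sum>k = 1..n. h k * x k) \<le> 1 + \<delta>"
      using range by eventually_elim (use \<delta> in \<open>auto simp: t_def\<close>)
    show "AE x in \<mu>. (\<integral>y. normal_density (\<Sum>k = 1..n. h k * x k) \<sigma> y * \<psi> y * indicator {0..1 + \<delta>} y \<partial>lborel) \<le> \<kappa> x"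
      using range
    proof eventually_elim
      case (elim x)
      have "(\<integral>y. normal_density (t 0 x) \<sigma> y * \<psi> y * indicator {0..1 + \<delta>} y \<partial>lborel)
        = (\<integral>y. (\<Sum>i = 0..n - 1. lam i *
            (normal_density (t 0 x) \<sigma> y * max (y - H_sum h i) 0 * indicator {0..1 + \<delta>} y)) \<partial>lborel)"
        by (intro Bochner_Integration.integral_cong)
           (auto simp: indicator_def \<psi>_eq sum_distrib_left mult_ac)
      also have "\<dots> = (\<Sum>i = 0..n - 1. lam i *
          (\<integral>y. normal_density (t 0 x) \<sigma> y * max (y - H_sum h i) 0 * indicator {0..1 + \<delta>} y \<partial>lborel))"
        using n H_sum_range[OF h]
        by (subst Bochner_Integration.integral_sum)
           (auto intro!: integrable_normal_hinge[OF \<sigma>])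
      also have "\<dots> \<le> \<kappa> x"
        unfolding \<kappa>_def using elim n by (intro sum_mono c) auto
      finally show ?case by (simp add: t_def)
    qed
  qed (use \<mu> \<delta> cont \<kappa> in \<open>auto simp: admissible_laws_def has_bochner_integral_iff
      intro: borel_measurable_continuous_onI\<close>)
  also have "(LBINT y:{0..1 + \<delta>}. exp (- \<psi> y)) = P_integral n h \<delta> lam"
    by (simp add: P_integral_def \<psi>_def)
  also have "(\<integral>x. \<kappa> x \<partial>\<mu>) = (\<Sum>i = 0..n - 1. lam i * (1 - H_sum h i) * alpha_bar n h \<alpha> i) + (\<Sum>i = 0..n - 1. c i)"
  proof -
    have "lam i * (\<Sum>k = i+1..n. h k * \<alpha> k) = lam i * (1 - H_sum h i) * alpha_bar n h \<alpha> i"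
      if "i \<in> {0..n - 1}" for i
    proof -
      have "H_sum h i < 1" using that n by (intro H_sum_range(2)[OF h]) auto
      then show ?thesis by (simp add: alpha_bar_def)
    qed
    then have "(\<Sum>i = 0..n - 1. lam i * (\<Sum>k = i+1..n. h k * \<alpha> k))
        = (\<Sum>i = 0..n - 1. lam i * (1 - H_sum h i) * alpha_bar n h \<alpha> i)"
      by (rule sum.cong[OF refl])
    then show ?thesis
      unfolding has_bochner_integral_integral_eq[OF \<kappa>] by (simp add: sum.distrib)
  qed
  finally show "ereal (channel_mutual_information n h \<sigma> \<mu>) \<le> ereal (
    ln (1 + P_integral n h \<delta> lam / (sqrt (2 * pi * exp 1) * \<sigma>))
    + (\<Sum>i = 0..n - 1. lam i * (1 - H_sum h i) * alpha_bar n h \<alpha> i) + (\<Sum>i = 0..n - 1. c i))"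
    by (simp add: add.assoc)
qed

theorem theorem7:
  fixes n :: nat and h \<alpha> :: "nat \<Rightarrow> real" and \<sigma> \<delta> :: real
  assumes "n \<ge> 2"
    and "\<forall>k\<in>{1..n}. h k > 0"
    and "(\<Sum>k = 1..n. h k) = 1"
    and "\<alpha> 1 \<le> 1"
    and "\<forall>k\<in>{1..<n}. \<alpha> k > \<alpha> (k + 1)"
    and "\<alpha> n > 0"
    and "\<alpha> n \<le> 1 / 2"
    and "\<sigma> > 0"
    and "\<delta> > 0"
  shows
    "(\<forall>lam :: nat \<Rightarrow> real. (\<forall>i\<in>{0..n - 1}. lam i \<ge> 0) \<longrightarrow>
        EC_OIC_capacity n h \<alpha> \<sigma> \<le> ereal (
          ln (1 + P_integral n h \<delta> lam / (sqrt (2 * pi * exp 1) * \<sigma>))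
          + (\<Sum>i = 0..n - 1. lam i * (1 - H_sum h i) * alpha_bar n h \<alpha> i)
          + (\<Sum>i = 0..n - 1. lam i * \<sigma> / sqrt (2 * pi) * (1 - exp (- ((1 + \<delta>)\<^sup>2 / (2 * \<sigma>\<^sup>2))))))) \<and>
     (\<forall>lam :: nat \<Rightarrow> real. lam 0 \<le> 0 \<and> (\<forall>i\<in>{1..n - 1}. lam i \<ge> 0) \<longrightarrow>
        EC_OIC_capacity n h \<alpha> \<sigma> \<le> ereal (
          ln (1 + P_integral n h \<delta> lam / (sqrt (2 * pi * exp 1) * \<sigma>))
          + (\<Sum>i = 0..n - 1. lam i * (1 - H_sum h i) * alpha_bar n h \<alpha> i)
          + (\<Sum>i = 1..n - 1. lam i * \<sigma> / sqrt (2 * pi) * (1 - exp (- ((1 + \<delta>)\<^sup>2 / (2 * \<sigma>\<^sup>2)))))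
          + lam 0 * \<sigma> * (std_normal_density (1 / \<sigma>) - std_normal_density (\<delta> / \<sigma>))
          - lam 0 * (Q_fun (1 / \<sigma>) + Q_fun (\<delta> / \<sigma>))))"
proof (intro conjI allI impI)
  have n: "n \<ge> 1" using assms(1) by simp
  define e where "e = 1 - exp (- ((1 + \<delta>)\<^sup>2 / (2 * \<sigma>\<^sup>2)))"
  \<comment> \<open>\<open>t\<close> dominates the noiseless hinge, being nonnegative and at least
    \<open>m - H_sum h i\<close>; a nonnegative weight preserves the estimate.\<close>
  have hinge: "lam i * (\<integral>y. normal_density m \<sigma> y * max (y - H_sum h i) 0 * indicator {0..1 + \<delta>} y \<partial>lborel)
      \<le> lam i * t + lam i * \<sigma> / sqrt (2 * pi) * e"
    if "i < n" "0 \<le> lam i" "0 \<le> m" "m \<le> 1" "0 \<le> t" "m - H_sum h i \<le> t" for lam :: "nat \<Rightarrow> real" and i m t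
  proof -
    have "(\<integral>y. normal_density m \<sigma> y * max (y - H_sum h i) 0 * indicator {0..1 + \<delta>} y \<partial>lborel)
        \<le> max (m - H_sum h i) 0 + \<sigma> / sqrt (2 * pi) * e"
      unfolding e_def using that assms H_sum_range[OF assms(2,3) \<open>i < n\<close>] by (intro normal_hinge_le) auto
    also have "\<dots> \<le> t + \<sigma> / sqrt (2 * pi) * e" using that by simp
    finally have "lam i * (\<integral>y. normal_density m \<sigma> y * max (y - H_sum h i) 0 * indicator {0..1 + \<delta>} y \<partial>lborel)
        \<le> lam i * (t + \<sigma> / sqrt (2 * pi) * e)"
      using that(2) by (rule mult_left_mono)
    then show ?thesis by (simp add: distrib_left)
  qed
  fix lam :: "nat \<Rightarrow> real"
  show "EC_OIC_capacity n h \<alpha> \<sigma> \<le> ereal (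
      ln (1 + P_integral n h \<delta> lam / (sqrt (2 * pi * exp 1) * \<sigma>))
      + (\<Sum>i = 0..n - 1. lam i * (1 - H_sum h i) * alpha_bar n h \<alpha> i)
      + (\<Sum>i = 0..n - 1. lam i * \<sigma> / sqrt (2 * pi) * (1 - exp (- ((1 + \<delta>)\<^sup>2 / (2 * \<sigma>\<^sup>2))))))"
    if lam: "\<forall>i\<in>{0..n - 1}. lam i \<ge> 0"
    unfolding e_def[symmetric] using lam by (intro capacity_le[OF n assms(2,3,8,9)] hinge) auto
  show "EC_OIC_capacity n h \<alpha> \<sigma> \<le> ereal (
      ln (1 + P_integral n h \<delta> lam / (sqrt (2 * pi * exp 1) * \<sigma>))
      + (\<Sum>i = 0..n - 1. lam i * (1 - H_sum h i) * alpha_bar n h \<alpha> i)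
      + (\<Sum>i = 1..n - 1. lam i * \<sigma> / sqrt (2 * pi) * (1 - exp (- ((1 + \<delta>)\<^sup>2 / (2 * \<sigma>\<^sup>2)))))
      + lam 0 * \<sigma> * (std_normal_density (1 / \<sigma>) - std_normal_density (\<delta> / \<sigma>))
      - lam 0 * (Q_fun (1 / \<sigma>) + Q_fun (\<delta> / \<sigma>)))"
    if lam: "lam 0 \<le> 0 \<and> (\<forall>i\<in>{1..n - 1}. lam i \<ge> 0)"
  proof -
    \<comment> \<open>The excess in the lower bound \<open>normal_truncated_mean_ge\<close>;
      multiplication by \<open>lam 0 \<le> 0\<close> turns that into the required upper
      bound.\<close>
    define d where "d = \<sigma> * (std_normal_density (1 / \<sigma>) - std_normal_density (\<delta> / \<sigma>))
      - (Q_fun (1 / \<sigma>) + Q_fun (\<delta> / \<sigma>))"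
    define c where "c i = (if i = 0 then lam 0 * d else lam i * \<sigma> / sqrt (2 * pi) * e)" for i
    have "EC_OIC_capacity n h \<alpha> \<sigma> \<le> ereal (
      ln (1 + P_integral n h \<delta> lam / (sqrt (2 * pi * exp 1) * \<sigma>))
      + (\<Sum>i = 0..n - 1. lam i * (1 - H_sum h i) * alpha_bar n h \<alpha> i) + (\<Sum>i = 0..n - 1. c i))"
    proof (rule capacity_le[OF n assms(2,3,8,9)])
      fix i m t assume i: "i < n" and m: "0 \<le> m" "m \<le> 1" and t: "0 \<le> t" "m - H_sum h i \<le> t" "i = 0 \<Longrightarrow> t = m"
      show "lam i * (\<integral>y. normal_density m \<sigma> y * max (y - H_sum h i) 0 * indicator {0..1 + \<delta>} y \<partial>lborel)
          \<le> lam i * t + c i"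
      proof (cases "i = 0")
        case True
        have "m + d \<le> (\<integral>y. normal_density m \<sigma> y * max (y - 0) 0 * indicator {0..1 + \<delta>} y \<partial>lborel)"
          unfolding d_def using assms m by (intro normal_truncated_mean_ge) auto
        then have "lam 0 * (\<integral>y. normal_density m \<sigma> y * max (y - 0) 0 * indicator {0..1 + \<delta>} y \<partial>lborel)
            \<le> lam 0 * (m + d)"
          using lam by (intro mult_left_mono_neg) auto
        then show ?thesis using True t(3) by (simp add: c_def H_sum_def distrib_left)
      next
        case False
        then show ?thesis using hinge[OF i _ m t(1,2), of lam] lam i by (simp add: c_def)
      qed
    qed
    also have "(\<Sum>i = 0..n - 1. c i) = lam 0 * d + (\<Sum>i = 1..n - 1. lam i * \<sigma> / sqrt (2 * pi) * e)"
      by (subst sum.atLeast_Suc_atMost) (auto simp: c_def)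
    also have "a + (lam 0 * d + b) = a + b
        + lam 0 * \<sigma> * (std_normal_density (1 / \<sigma>) - std_normal_density (\<delta> / \<sigma>))
        - lam 0 * (Q_fun (1 / \<sigma>) + Q_fun (\<delta> / \<sigma>))" for a b
      by (simp add: d_def algebra_simps)
    finally show ?thesis
      by (simp only: e_def)
  qed
qed

end
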